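(* Let $m\ge 6$ and $n=3m+1$ or $n=3m+2$. Suppose that $\mathcal F_1,\mathcal F_2,\mathcal F_3\subset 2^{[n]}$ are cross partition-free. Then $$|\mathcal F_1|+|\mathcal F_2|+|\mathcal F_3|\le 3\sum_{t=m+1}^{2m+1}\binom{n}{t}.$$ Moreover, for $n=3m+1$ equality holds only when $\mathcal F_1=\mathcal F_2=\mathcal F_3=\mathcal K(3m+1)$. For $n=3m+2$ equality holds, up to a permutation of the indices of the families and of the elements of the ground set, only in the following three cases: (i) $\mathcal F_1=\mathcal F_2=\mathcal F_3=\mathcal K(3m+2)$; (ii) $\mathcal F_1=\mathcal F_2=\mathcal F_3=\mathcal K(3m+1)^d$; (iii) $\mathcal F_1=\{F\subset[n]: m+2\le|F|\le 2m+1\}$ and $\mathcal F_2=\mathcal F_3=\{F\subset[n]: m+1\le|F|\le 2m+2\}$.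
   Context: Three families $\mathcal F_1,\mathcal F_2,\mathcal F_3\subset 2^{[n]}$ are cross partition-free if there is no choice of $A\in\mathcal F_1$, $B\in\mathcal F_2$, $C\in\mathcal F_3$ such that one of these three sets equals the disjoint union of the other two. For $n=3m+l$, $0\le l\le 2$, $\mathcal K(n):=\{K\subset[n]: m+1\le|K|\le 2m+1\}$. For $\mathcal G\subset 2^{[n]}$, $\mathcal G^d:=\{F\subset[n+1]: F\cap[n]\in\mathcal G\}$; thus $\mathcal K(3m+1)^d\subset 2^{[3m+2]}$. *)

theory Defs
  imports Main "HOL-Combinatorics.Permutations"
begin

text \<open>
  The ground set \<open>[n]\<close> is \<open>{1..n}\<close>. A triple of families is a function on indices, of which
  only the values at \<open>1\<close>, \<open>2\<close>, \<open>3\<close> matter.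
\<close>

definition is_disjoint_union :: "'a set \<Rightarrow> 'a set \<Rightarrow> 'a set \<Rightarrow> bool" where
  "is_disjoint_union C A B \<longleftrightarrow> A \<inter> B = {} \<and> C = A \<union> B"

text \<open>The empty set is allowed as a part: \<open>A\<close> is the disjoint union of \<open>A\<close> and \<open>{}\<close>.\<close>

definition cross_partition_free :: "(nat \<Rightarrow> 'a set set) \<Rightarrow> bool" where
  "cross_partition_free F \<longleftrightarrow>
     \<not> (\<exists>A\<in>F 1. \<exists>B\<in>F 2. \<exists>C\<in>F 3.
          is_disjoint_union A B C \<or> is_disjoint_union B A C \<or> is_disjoint_union C A B)"

definition layers :: "nat \<Rightarrow> nat \<Rightarrow> nat \<Rightarrow> nat set set" where
  "layers n a b = {F. F \<subseteq> {1..n} \<and> a \<le> card F \<and> card F \<le> b}"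

text \<open>Here \<open>n div 3\<close> is the \<open>m\<close> with \<open>n = 3 * m + l\<close>, \<open>0 \<le> l \<le> 2\<close>.\<close>

definition KK :: "nat \<Rightarrow> nat set set" where
  "KK n = layers n (n div 3 + 1) (2 * (n div 3) + 1)"

text \<open>For \<open>G\<close> a family of subsets of \<open>{1..n}\<close>, this is \<open>G\<^sup>d\<close>, a family of subsets of \<open>{1..n + 1}\<close>.\<close>

definition doubling :: "nat \<Rightarrow> nat set set \<Rightarrow> nat set set" where
  "doubling n G = {F. F \<subseteq> {1..n + 1} \<and> F \<inter> {1..n} \<in> G}"

text \<open>
  Equality of triples up to a permutation \<open>\<sigma>\<close> of the indices and one permutation \<open>\<pi>\<close> of the
  ground set, the same for all three families.
\<close>

definition same_up_to_perm ::
    "nat \<Rightarrow> (nat \<Rightarrow> nat set set) \<Rightarrow> (nat \<Rightarrow> nat set set) \<Rightarrow> bool" where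
  "same_up_to_perm n F G \<longleftrightarrow>
     (\<exists>\<sigma> \<pi>. \<sigma> permutes {1, 2, 3} \<and> \<pi> permutes {1..n} \<and>
        (\<forall>i\<in>{1, 2, 3}. F (\<sigma> i) = (\<lambda>A. \<pi> ` A) ` G i))"

end

theory Submission
  imports Defs Complex_Main
begin

text \<open>
  For disjoint \<open>P\<close> and \<open>Q\<close> the \<open>3 \<times> 3\<close> incidence matrix between \<open>P\<close>, \<open>Q\<close>, \<open>P \<union> Q\<close> and the three families has no transversal, so by Koenig at most 6 of its entries are 1. Averaging over all
  permutations of the ground set gives \<open>f\<^sub>p + f\<^sub>q + f\<^bsub>p+q\<^esub> \<le> 6\<close> for the densities \<open>0 \<le> f\<^sub>k \<le> 3\<close> of the layers.
  These inequalities alone do not imply the bound: the layers \<open>m + 1\<close> and \<open>2 m + 1\<close> would be charged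
  too often. They are supplemented by an integral local inequality. Put \<open>a = n - (2 m + 2)\<close>, take
  disjoint \<open>(m + 1)\<close>-sets \<open>B\<^sub>1\<close>, \<open>B\<^sub>2\<close>, an \<open>a\<close>-set \<open>A \<subseteq> B\<^sub>2\<close>, a point \<open>x\<close> outside, and charge the sets \<open>A\<close>,
  \<open>B\<^sub>1 \<union> B\<^sub>2\<close> and \<open>B\<^sub>1 \<union> B\<^sub>2 \<union> {x}\<close> simultaneously to missing copies of \<open>B\<^sub>1\<close> and \<open>B\<^sub>2\<close> and, at a small
  cost, of sets in the layers strictly inside. Together with the averaged inequalities it
  uses up layer \<open>m + 1\<close> exactly and leaves slack on the layers \<open>m + 2, \<dots>, a + m + 1\<close>,
  which are therefore full in the case of equality. Then the local inequality is tight everywhere, which determines the remaining layers up to the choice of a star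
  of \<open>(m + 1)\<close>-sets.
\<close>

section \<open>Three families on a few sets\<close>

text \<open>The sets are the rows and the families the columns of a 0/1 matrix. All six assignments
  are excluded, because \<open>cross_partition_free\<close> lets the union come from any of the
  three families.\<close>

definition transversal_free :: "(nat \<Rightarrow> bool) \<Rightarrow> (nat \<Rightarrow> bool) \<Rightarrow> (nat \<Rightarrow> bool) \<Rightarrow> bool" where
  "transversal_free P Q R \<longleftrightarrow> (\<forall>i\<in>{1, 2, 3}. \<forall>j\<in>{1, 2, 3}. \<forall>k\<in>{1, 2, 3}.
     i \<noteq> j \<longrightarrow> i \<noteq> k \<longrightarrow> j \<noteq> k \<longrightarrow> \<not> (P i \<and> Q j \<and> R k))"

definition weight :: "(nat \<Rightarrow> bool) \<Rightarrow> real" where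
  "weight P = (\<Sum>i\<in>{1, 2, 3}. of_bool (P i))"

lemma weight_eq: "weight P = of_bool (P 1) + of_bool (P 2) + of_bool (P 3)"
  by (simp add: weight_def)

lemma transversal_free_iff:
  "transversal_free P Q R \<longleftrightarrow>
     \<not> (P 1 \<and> Q 2 \<and> R 3) \<and> \<not> (P 1 \<and> Q 3 \<and> R 2) \<and> \<not> (P 2 \<and> Q 1 \<and> R 3) \<and>
     \<not> (P 2 \<and> Q 3 \<and> R 1) \<and> \<not> (P 3 \<and> Q 1 \<and> R 2) \<and> \<not> (P 3 \<and> Q 2 \<and> R 1)"
  by (auto simp: transversal_free_def)

lemma weight_bounds: "0 \<le> weight P" "weight P \<le> 3"
  by (auto simp: weight_eq of_bool_def)

text \<open>Without a transversal, two lines of the matrix cover all ones, and a line has three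
  cells.\<close>

lemma koenig:
  assumes "transversal_free P Q R"
  shows "weight P + weight Q + weight R \<le> 6"
  using assms unfolding transversal_free_iff weight_eq of_bool_def by (smt (verit))

text \<open>With deficits \<open>3 - weight\<close>: the deficits of \<open>B1\<close>,
  \<open>B2\<close>, \<open>AB\<close>, \<open>E\<close> pay for \<open>A\<close> and
  \<open>D\<close> at once. Adding Koenig for the first and the third triple would charge
  \<open>B1\<close> twice; the triple with \<open>E\<close> saves one of these charges.\<close>

lemma local_core:
  assumes "transversal_free A B1 AB" "transversal_free A E D" "transversal_free B1 B2 D"
  shows "weight A + weight D \<le> 12 - weight B1 - weight B2 - weight AB - weight E"
  using assms unfolding transversal_free_iff weight_eq of_bool_def by (smt (verit))

text \<open>Either the deficits of \<open>G1\<close> and \<open>G2\<close> pay for \<open>D\<close>,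
  or together with twice the deficits of \<open>B1\<close> and \<open>B2\<close> they pay for
  \<open>D\<close> and leave 6 units over.\<close>

lemma local_top:
  assumes "transversal_free B1 G1 D" "transversal_free B2 G2 D"
  shows "weight D \<le> 6 - weight G1 - weight G2 \<or>
    weight D \<le> 12 - 2 * weight B1 - 2 * weight B2 - weight G1 - weight G2"
  using assms unfolding transversal_free_iff weight_eq of_bool_def by (smt (verit))

definition full :: "(nat \<Rightarrow> bool) \<Rightarrow> bool" where "full P \<longleftrightarrow> (\<forall>i\<in>{1, 2, 3}. P i)"
definition none :: "(nat \<Rightarrow> bool) \<Rightarrow> bool" where "none P \<longleftrightarrow> (\<forall>i\<in>{1, 2, 3}. \<not> P i)"

lemma full_iff: "full P \<longleftrightarrow> weight P = 3"
  by (auto simp: full_def weight_eq of_bool_def)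
lemma none_iff: "none P \<longleftrightarrow> weight P = 0"
  by (auto simp: none_def weight_eq of_bool_def)

lemma transversal_free_swap: "transversal_free P Q R \<Longrightarrow> transversal_free P R Q"
  unfolding transversal_free_def by metis

lemma transversal_free_rotate: "transversal_free P Q R \<Longrightarrow> transversal_free R P Q"
  unfolding transversal_free_def by metis

text \<open>In the first case of \<open>local_top\<close> add twice \<open>local_core\<close>. In
  the second case Koenig for \<open>A\<close>, \<open>E\<close>, \<open>D0\<close> and
  \<open>weight AB \<le> 3\<close> bound the remaining terms by 18.\<close>

lemma local_inequality:
  assumes "transversal_free A B1 AB" "transversal_free A E D0" "transversal_free B1 B2 D0"
    and "transversal_free B1 G1 D1" "transversal_free B2 G2 D1"
  shows "2 * weight A + 2 * weight D0 + weight D1 + 2 * weight B1 + 2 * weight B2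
    + 2 * weight AB + 2 * weight E + weight G1 + weight G2 \<le> 30"
  using local_core[OF assms(1-3)] local_top[OF assms(4,5)] koenig[OF assms(2)]
    weight_bounds[of A] weight_bounds[of B1] weight_bounds[of AB]
  by linarith

text \<open>Once the middle sets are full, 12 of the 30 units remain. The second configuration, with
  \<open>A'\<close>, exchanges the roles of \<open>B1\<close> and \<open>B2\<close>, so that both
  halves can be compared with an \<open>a\<close>-set.\<close>

lemma local_equality:
  assumes "transversal_free A B1 AB" "transversal_free A E D0" "transversal_free B1 B2 D0"
    and "transversal_free B1 G1 D1" "transversal_free B2 G2 D1"
    and "transversal_free A' B2 AB'" "transversal_free A' E' D0"
    and "full AB" "full E" "full G1" "full G2" "full AB'" "full E'"
    and eq: "2 * weight A + 2 * weight D0 + weight D1 + 2 * weight B1 + 2 * weight B2 = 12"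
      "2 * weight A' + 2 * weight D0 + weight D1 + 2 * weight B1 + 2 * weight B2 = 12"
  shows "none A \<and> none D1 \<and>
    (full B1 \<and> full B2 \<and> none D0 \<or>
     weight B1 = 2 \<and> (\<forall>i\<in>{1, 2, 3}. B2 i = B1 i \<and> D0 i = B1 i) \<or>
     full B1 \<and> none B2 \<and> full D0 \<or> none B1 \<and> full B2 \<and> full D0)"
proof -
  \<comment> \<open>Next to a full \<open>R\<close>, the rows \<open>P\<close> and \<open>Q\<close>
    have no ones in different columns; if both are nonempty, they are the same singleton.\<close>
  have block: "weight P = 0 \<or> 1 \<le> weight P \<and> weight P + 2 * weight Q \<le> 3"
    if "transversal_free P Q R" "full R" for P Q R
  proof -
    have "R 1" "R 2" "R 3" using that(2) by (auto simp: full_def)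
    then show ?thesis
      using that(1) unfolding transversal_free_iff weight_eq of_bool_def by (smt (verit))
  qed
  have tf: "transversal_free A D0 E" "transversal_free A' D0 E'"
    "transversal_free D1 B1 G1" "transversal_free D1 B2 G2"
    by (fact transversal_free_swap[OF assms(2)] transversal_free_swap[OF assms(7)]
      transversal_free_rotate[OF assms(4)] transversal_free_rotate[OF assms(5)])+
  have D1: "weight D1 = 0"
  proof (rule ccontr)
    assume "weight D1 \<noteq> 0"
    then have "1 \<le> weight D1" "weight D1 + 2 * weight B1 \<le> 3" "weight D1 + 2 * weight B2 \<le> 3"
      using block[OF tf(3) assms(10)] block[OF tf(4) assms(11)] by auto
    moreover have "weight A + weight D0 \<le> 3"
      using koenig[OF assms(2)] assms(9) by (simp add: full_iff)
    ultimately show False using eq(1) by linarith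
  qed
  have "weight A' = weight A" using eq by simp
  have A: "weight A = 0"
  proof (rule ccontr)
    assume "weight A \<noteq> 0"
    then have "weight A + 2 * weight B1 \<le> 3" "weight A + 2 * weight D0 \<le> 3"
      "weight A + 2 * weight B2 \<le> 3" "1 \<le> weight A"
      using block[OF assms(1,8)] block[OF tf(1) assms(9)] block[OF assms(6,12)] \<open>weight A' = weight A\<close>
      by auto
    then show False using D1 eq(1) by linarith
  qed
  \<comment> \<open>Six ones without a transversal fill two lines completely. A row and a column
    cover only five cells, so two rows or two columns are filled: the four cases below.\<close>
  have "weight B1 + weight B2 + weight D0 = 6" using eq(1) A D1 by simp
  then have "full B1 \<and> full B2 \<and> none D0 \<or>
     weight B1 = 2 \<and> (\<forall>i\<in>{1, 2, 3}. B2 i = B1 i \<and> D0 i = B1 i) \<or>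
     full B1 \<and> none B2 \<and> full D0 \<or> none B1 \<and> full B2 \<and> full D0"
    using assms(3) unfolding transversal_free_iff none_def full_def weight_eq
    by (cases "B1 1"; cases "B1 2"; cases "B1 3"; cases "D0 1"; cases "D0 2"; cases "D0 3";
        simp add: of_bool_def split: if_splits)
  then show ?thesis using A D1 by (simp add: none_iff)
qed

section \<open>Averaging over permutations\<close>

lemma bij_betw_extend:
  assumes "bij_betw f S S'" "S \<subseteq> T" "S' \<subseteq> T'" "finite T" "finite T'" "card T = card T'"
  obtains g where "bij_betw g T T'" "\<And>x. x \<in> S \<Longrightarrow> g x = f x"
proof -
  have "card S = card S'" using assms(1) by (rule bij_betw_same_card)
  then have "card (T - S) = card (T' - S')"
    using assms by (metis card_Diff_subset finite_subset)
  then obtain h where h: "bij_betw h (T - S) (T' - S')"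
    using assms(4,5) by (meson finite_Diff finite_same_card_bij)
  define g where "g = (\<lambda>x. if x \<in> S then f x else h x)"
  have "bij_betw g S S'" using assms(1) by (rule bij_betw_cong[THEN iffD1, rotated]) (simp add: g_def)
  moreover have "bij_betw g (T - S) (T' - S')"
    using h by (rule bij_betw_cong[THEN iffD1, rotated]) (simp add: g_def)
  ultimately have "bij_betw g (S \<union> (T - S)) (S' \<union> (T' - S'))" by (rule bij_betw_combine) auto
  moreover have "S \<union> (T - S) = T" "S' \<union> (T' - S') = T'" using assms by auto
  ultimately show thesis using that[of g] by (simp add: g_def)
qed

lemma permutation_extend:
  assumes "bij_betw f S S'" "S \<subseteq> U" "S' \<subseteq> U" "finite U"
  obtains p where "p permutes U" "\<And>x. x \<in> S \<Longrightarrow> p x = f x"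
proof -
  obtain g where g: "bij_betw g U U" "\<And>x. x \<in> S \<Longrightarrow> g x = f x"
    using bij_betw_extend[OF assms(1-3) assms(4) assms(4)] by auto
  have "(\<lambda>x. if x \<in> U then g x else x) permutes U"
    using g(1) by (intro bij_imp_permutes) (auto cong: bij_betw_cong)
  then show thesis using that g(2) assms(2) by (smt (verit) subsetD)
qed

section \<open>Layer densities as averages over all permutations\<close>

definition level :: "nat \<Rightarrow> nat \<Rightarrow> nat set set" where
  "level n k = {S. S \<subseteq> {1..n} \<and> card S = k}"

lemma finite_level: "finite (level n k)"
  unfolding level_def by (rule finite_subset[of _ "Pow {1..n}"]) auto

lemma card_level: "card (level n k) = n choose k"
  unfolding level_def using n_subsets[of "{1..n}" k] by simp

lemma card_permutations_interval: "card {p. p permutes {1..n}} = fact n"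
  using card_permutations[of "{1..n}" n] by simp

text \<open>A random permutation maps \<open>S\<close> to a uniformly random set of its size.
  Composition with a permutation that takes \<open>S\<close> to \<open>T\<close> makes the sum the
  same for every \<open>T\<close> of the level; interchanging the sums over \<open>T\<close> and
  \<open>p\<close> evaluates it.\<close>

lemma sum_permutations_image:
  fixes h :: "nat set \<Rightarrow> real"
  assumes "S \<subseteq> {1..n}"
  shows "(\<Sum>p | p permutes {1..n}. h (p ` S)) = fact n / (n choose card S) * (\<Sum>T\<in>level n (card S). h T)"
proof -
  let ?P = "{p. p permutes {1..n}}" and ?L = "level n (card S)"
  have S: "(\<Sum>p\<in>?P. h (p ` T)) = (\<Sum>p\<in>?P. h (p ` S))" if "T \<in> ?L" for T
  proof -
    have T: "T \<subseteq> {1..n}" "card S = card T" using that by (auto simp: level_def)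
    then obtain f where "bij_betw f S T"
      using assms by (meson finite_atLeastAtMost finite_same_card_bij finite_subset)
    then obtain q where q: "q permutes {1..n}" "\<And>x. x \<in> S \<Longrightarrow> q x = f x"
      using permutation_extend[of f S T "{1..n}"] assms T by auto
    have "q ` S = T" using q(2) \<open>bij_betw f S T\<close> by (auto simp: bij_betw_def)
    then show ?thesis
      using sum_permutations_compose_right[OF q(1), of "\<lambda>p. h (p ` S)"]
      by (simp only: image_comp[symmetric])
  qed
  have inv: "(\<Sum>T\<in>?L. h (p ` T)) = (\<Sum>T\<in>?L. h T)" if "p \<in> ?P" for p
  proof (rule sum.reindex_bij_betw)
    have p: "p permutes {1..n}" using that by simp
    have "inj p" using p by (rule permutes_inj)
    show "bij_betw ((`) p) ?L ?L"
      unfolding bij_betw_def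
    proof
      show "inj_on ((`) p) ?L" using \<open>inj p\<close> by (simp add: inj_on_def inj_image_eq_iff)
      have "(`) p ` ?L \<subseteq> ?L"
        using image_mono[of _ "{1..n}" p] permutes_image[OF p] card_image[OF inj_on_subset[OF \<open>inj p\<close>]]
        by (auto simp: level_def simp del: One_nat_def)
      moreover have "card ((`) p ` ?L) = card ?L"
        using \<open>inj p\<close> by (intro card_image) (simp add: inj_on_def inj_image_eq_iff)
      ultimately show "(`) p ` ?L = ?L" by (simp add: card_subset_eq finite_level)
    qed
  qed
  have "fact n * (\<Sum>T\<in>?L. h T) = (\<Sum>p\<in>?P. \<Sum>T\<in>?L. h (p ` T))"
    using inv by (simp add: card_permutations_interval del: One_nat_def)
  also have "\<dots> = (\<Sum>T\<in>?L. \<Sum>p\<in>?P. h (p ` T))" by (rule sum.swap)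
  also have "\<dots> = (n choose card S) * (\<Sum>p\<in>?P. h (p ` S))" using S by (simp add: card_level)
  finally have "fact n * (\<Sum>T\<in>?L. h T) = (n choose card S) * (\<Sum>p\<in>?P. h (p ` S))" .
  moreover have "card S \<le> n" using card_mono[OF _ assms] by simp
  ultimately show ?thesis by (simp add: field_simps)
qed

text \<open>The sum of the three proportions of layer \<open>k\<close>, hence between 0 and 3. For
  \<open>k > n\<close> division by zero gives 0, so the bounds hold for every
  \<open>k\<close>.\<close>

definition density :: "nat \<Rightarrow> (nat \<Rightarrow> nat set set) \<Rightarrow> nat \<Rightarrow> real" where
  "density n F k = (\<Sum>S\<in>level n k. weight (\<lambda>i. S \<in> F i)) / (n choose k)"

lemma sum_permutations_weight:
  assumes "S \<subseteq> {1..n}"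
  shows "(\<Sum>p | p permutes {1..n}. weight (\<lambda>i. p ` S \<in> F i)) = fact n * density n F (card S)"
  using sum_permutations_image[OF assms, of "\<lambda>S. weight (\<lambda>i. S \<in> F i)"] by (simp add: density_def)

lemma density_bounds: "0 \<le> density n F k" "density n F k \<le> 3"
proof -
  show "0 \<le> density n F k" unfolding density_def by (simp add: sum_nonneg weight_bounds)
  have "(\<Sum>S\<in>level n k. weight (\<lambda>i. S \<in> F i)) \<le> 3 * (n choose k)"
    using sum_bounded_above[of "level n k" "\<lambda>S. weight (\<lambda>i. S \<in> F i)" 3]
    by (simp add: weight_bounds card_level mult.commute)
  then show "density n F k \<le> 3"
    unfolding density_def by (cases "n choose k = 0") (simp_all add: divide_le_eq)
qed

lemma density_mult:
  "k \<le> n \<Longrightarrow> (n choose k) * density n F k = (\<Sum>S\<in>level n k. weight (\<lambda>i. S \<in> F i))"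
  by (simp add: density_def)

lemma density_zero:
  assumes "k \<le> n" "density n F k = 0" "S \<in> level n k"
  shows "none (\<lambda>i. S \<in> F i)"
proof -
  have "(\<Sum>S\<in>level n k. weight (\<lambda>i. S \<in> F i)) = 0" using density_mult[OF assms(1), of F] assms(2) by simp
  then show ?thesis
    using assms(3) by (simp add: sum_nonneg_eq_0_iff finite_level weight_bounds none_iff)
qed

lemma density_three:
  assumes "k \<le> n" "density n F k = 3" "S \<in> level n k"
  shows "full (\<lambda>i. S \<in> F i)"
proof -
  have "(\<Sum>S\<in>level n k. 3 - weight (\<lambda>i. S \<in> F i)) = 0"
    using density_mult[OF assms(1), of F] assms(2) by (simp add: sum_subtractf card_level)
  then show ?thesis
    using assms(3) by (simp add: sum_nonneg_eq_0_iff finite_level weight_bounds full_iff)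
qed

lemma cross_transversal_free:
  assumes "cross_partition_free F" "P \<inter> Q = {}" "R = P \<union> Q"
  shows "transversal_free (\<lambda>i. P \<in> F i) (\<lambda>i. Q \<in> F i) (\<lambda>i. R \<in> F i)"
proof -
  have *: "is_disjoint_union R P Q" "is_disjoint_union R Q P"
    using assms by (auto simp: is_disjoint_union_def)
  show ?thesis
    using assms(1) * unfolding transversal_free_iff cross_partition_free_def by blast
qed

text \<open>Koenig for the images of two adjacent intervals and their union, averaged over all
  permutations.\<close>

lemma density_triple:
  assumes "cross_partition_free F" "a + b \<le> n"
  shows "density n F a + density n F b + density n F (a + b) \<le> 6"
proof -
  let ?P = "{p. p permutes {1..n}}"
  let ?A = "{1..a}" and ?B = "{a+1..a+b}" and ?C = "{1..a+b}"
  have "(\<Sum>p\<in>?P. weight (\<lambda>i. p ` ?A \<in> F i) + weight (\<lambda>i. p ` ?B \<in> F i) + weight (\<lambda>i. p ` ?C \<in> F i))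
      \<le> (\<Sum>p\<in>?P. 6)"
  proof (rule sum_mono)
    fix p assume "p \<in> ?P"
    then have "inj p" by (auto dest: permutes_inj)
    have "?A \<inter> ?B = {}" "?C = ?A \<union> ?B" by auto
    then have "p ` ?A \<inter> p ` ?B = {}" "p ` ?C = p ` ?A \<union> p ` ?B"
      using \<open>inj p\<close> by (metis image_Int image_empty, metis image_Un)
    then show "weight (\<lambda>i. p ` ?A \<in> F i) + weight (\<lambda>i. p ` ?B \<in> F i) + weight (\<lambda>i. p ` ?C \<in> F i) \<le> 6"
      by (intro koenig cross_transversal_free assms(1))
  qed
  moreover have "?A \<subseteq> {1..n}" "?B \<subseteq> {1..n}" "?C \<subseteq> {1..n}" using assms(2) by auto
  ultimately have "fact n * density n F a + fact n * density n F b + fact n * density n F (a + b) \<le> fact n * 6"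
    by (simp add: sum.distrib sum_permutations_weight card_permutations_interval del: One_nat_def)
  then have "fact n * (density n F a + density n F b + density n F (a + b)) \<le> fact n * 6"
    by (simp add: algebra_simps)
  then show ?thesis by simp
qed

text \<open>
  The slack of the local inequality; the last six sets are the ones that are charged, the first
  three are paid for.
\<close>

definition excess :: "(nat \<Rightarrow> nat set set) \<Rightarrow> nat set \<Rightarrow> nat set \<Rightarrow> nat set \<Rightarrow> nat \<Rightarrow> real" where
  "excess F A B1 B2 x =
     30 - 2 * weight (\<lambda>i. A \<in> F i) - 2 * weight (\<lambda>i. B1 \<union> B2 \<in> F i) - weight (\<lambda>i. insert x (B1 \<union> B2) \<in> F i)
     - 2 * weight (\<lambda>i. B1 \<in> F i) - 2 * weight (\<lambda>i. B2 \<in> F i) - 2 * weight (\<lambda>i. A \<union> B1 \<in> F i)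
     - 2 * weight (\<lambda>i. B1 \<union> B2 - A \<in> F i) - weight (\<lambda>i. insert x B2 \<in> F i) - weight (\<lambda>i. insert x B1 \<in> F i)"

lemma excess_nonneg:
  assumes F: "cross_partition_free F" and "B1 \<inter> B2 = {}" "A \<subseteq> B2" "x \<notin> B1 \<union> B2"
  shows "0 \<le> excess F A B1 B2 x"
proof -
  have "transversal_free (\<lambda>i. A \<in> F i) (\<lambda>i. B1 \<in> F i) (\<lambda>i. A \<union> B1 \<in> F i)"
    "transversal_free (\<lambda>i. A \<in> F i) (\<lambda>i. B1 \<union> B2 - A \<in> F i) (\<lambda>i. B1 \<union> B2 \<in> F i)"
    "transversal_free (\<lambda>i. B1 \<in> F i) (\<lambda>i. B2 \<in> F i) (\<lambda>i. B1 \<union> B2 \<in> F i)"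
    "transversal_free (\<lambda>i. B1 \<in> F i) (\<lambda>i. insert x B2 \<in> F i) (\<lambda>i. insert x (B1 \<union> B2) \<in> F i)"
    "transversal_free (\<lambda>i. B2 \<in> F i) (\<lambda>i. insert x B1 \<in> F i) (\<lambda>i. insert x (B1 \<union> B2) \<in> F i)"
    by (rule cross_transversal_free[OF F]; use assms in auto)+
  from local_inequality[OF this] show ?thesis unfolding excess_def by simp
qed

text \<open>All configurations are images of one template, in which \<open>B2\<close> is the initial
  interval so that \<open>A\<close> can be an initial part of it. On average only the sizes of the
  nine sets count; two of them have size \<open>b\<close> and two have size \<open>b + 1\<close>,
  which merges their coefficients.\<close>

lemma sum_excess:
  assumes "a \<le> b" "2 * b + 1 \<le> n"
  shows "(\<Sum>p | p permutes {1..n}. excess F (p ` {1..a}) (p ` {b+1..2*b}) (p ` {1..b}) (p (2*b+1)))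
    = fact n * (30 - 2 * density n F a - 2 * density n F (2 * b) - density n F (2 * b + 1)
        - 4 * density n F b - 2 * density n F (a + b) - 2 * density n F (2 * b - a) - 2 * density n F (b + 1))"
proof -
  have 1: "excess F (p ` {1..a}) (p ` {b+1..2*b}) (p ` {1..b}) (p (2*b+1)) =
     30 - 2 * weight (\<lambda>i. p ` {1..a} \<in> F i) - 2 * weight (\<lambda>i. p ` {1..2*b} \<in> F i)
     - weight (\<lambda>i. p ` {1..2*b+1} \<in> F i)
     - 2 * weight (\<lambda>i. p ` {b+1..2*b} \<in> F i) - 2 * weight (\<lambda>i. p ` {1..b} \<in> F i)
     - 2 * weight (\<lambda>i. p ` ({1..a} \<union> {b+1..2*b}) \<in> F i)
     - 2 * weight (\<lambda>i. p ` {a+1..2*b} \<in> F i) - weight (\<lambda>i. p ` insert (2*b+1) {1..b} \<in> F i)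
     - weight (\<lambda>i. p ` {b+1..2*b+1} \<in> F i)"
    if "p \<in> {p. p permutes {1..n}}" for p
  proof -
    have "inj p" using that by (auto dest: permutes_inj)
    have "{b+1..2*b} \<union> {1..b} = {1..2*b}" "{1..2*b+1} = insert (2*b+1) {1..2*b}"
      "{b+1..2*b+1} = insert (2*b+1) {b+1..2*b}" "{a+1..2*b} = {1..2*b} - {1..a}" by auto
    then show ?thesis
      using \<open>inj p\<close> unfolding excess_def by (simp add: image_Un[symmetric] image_set_diff del: One_nat_def)
  qed
  have sub: "{1..a} \<subseteq> {1..n}" "{1..2*b} \<subseteq> {1..n}" "{1..2*b+1} \<subseteq> {1..n}" "{b+1..2*b} \<subseteq> {1..n}"
    "{1..b} \<subseteq> {1..n}" "{1..a} \<union> {b+1..2*b} \<subseteq> {1..n}" "{a+1..2*b} \<subseteq> {1..n}"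
    "insert (2*b+1) {1..b} \<subseteq> {1..n}" "{b+1..2*b+1} \<subseteq> {1..n}"
    using assms by auto
  have "card ({1..a} \<union> {b+1..2*b}) = card {1..a} + card {b+1..2*b}"
    using assms by (intro card_Un_disjoint) auto
  then have crd: "card ({1..a} \<union> {b+1..2*b}) = a + b" "card (insert (2*b+1) {1..b}) = b + 1"
    "card {b+1..2*b+1} = b + 1" "card {a+1..2*b} = 2 * b - a" by simp_all
  note weights = sub[THEN sum_permutations_weight]
  show ?thesis
    by (subst sum.cong[OF refl 1], assumption,
        simp only: sum_subtractf sum_distrib_left[symmetric] weights crd sum_constant
          card_permutations_interval card_atLeastAtMost)
      (simp add: algebra_simps)
qed

lemma density_local:
  assumes "cross_partition_free F" "a \<le> b" "2 * b + 1 \<le> n"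
  shows "2 * density n F a + 2 * density n F (2 * b) + density n F (2 * b + 1)
    \<le> 4 * (3 - density n F b) + 2 * (3 - density n F (a + b)) + 2 * (3 - density n F (2 * b - a))
      + 2 * (3 - density n F (b + 1))"
proof -
  have sum: "0 \<le> (\<Sum>p | p permutes {1..n}. excess F (p ` {1..a}) (p ` {b+1..2*b}) (p ` {1..b}) (p (2*b+1)))"
  proof (rule sum_nonneg)
    fix p assume "p \<in> {p. p permutes {1..n}}"
    then have "inj p" by (auto dest: permutes_inj)
    then show "0 \<le> excess F (p ` {1..a}) (p ` {b+1..2*b}) (p ` {1..b}) (p (2*b+1))"
      using assms(2) by (intro excess_nonneg assms(1)) (auto simp: inj_eq)
  qed
  have "0 \<le> x" if "0 \<le> fact n * x" for x :: real
    using that by (metis fact_gt_zero linorder_not_le mult_pos_neg)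
  from this[OF sum[unfolded sum_excess[OF assms(2,3)]]] show ?thesis by argo
qed

text \<open>Nonnegative terms with sum 0 vanish one by one. To reach a given configuration, a
  bijection is extended along the chain \<open>{1..a}\<close>, \<open>{1..b}\<close>,
  \<open>{1..2*b}\<close>, \<open>{1..2*b+1}\<close> and then to a permutation; \<open>B1\<close>
  and \<open>x\<close> are recovered as differences.\<close>

lemma excess_eq_0:
  assumes F: "cross_partition_free F"
    and tight: "2 * density n F a + 2 * density n F (2 * b) + density n F (2 * b + 1)
      = 4 * (3 - density n F b) + 2 * (3 - density n F (a + b)) + 2 * (3 - density n F (2 * b - a))
        + 2 * (3 - density n F (b + 1))"
    and "2 * b + 1 \<le> n" "B1 \<subseteq> {1..n}" "B2 \<subseteq> {1..n}" "x \<in> {1..n}"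
    and "card B1 = b" "card B2 = b" "B1 \<inter> B2 = {}" "A \<subseteq> B2" "card A = a" "x \<notin> B1 \<union> B2"
  shows "excess F A B1 B2 x = 0"
proof -
  have fin: "finite A" "finite B1" "finite B2" using assms by (meson finite_atLeastAtMost finite_subset)+
  have "a \<le> b" using assms fin card_mono by metis
  let ?e = "\<lambda>p. excess F (p ` {1..a}) (p ` {b+1..2*b}) (p ` {1..b}) (p (2*b+1))"
  have nonneg: "0 \<le> ?e p" if "p \<in> {p. p permutes {1..n}}" for p
  proof -
    have "inj p" using that by (auto dest: permutes_inj)
    then show ?thesis using \<open>a \<le> b\<close> by (intro excess_nonneg F) (auto simp: inj_eq)
  qed
  have "(\<Sum>p | p permutes {1..n}. ?e p) = 0"
    unfolding sum_excess[OF \<open>a \<le> b\<close> assms(3)] using tight by simp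
  then have zero: "?e p = 0" if "p permutes {1..n}" for p
    using that nonneg by (subst (asm) sum_nonneg_eq_0_iff) (auto simp: finite_permutations)
  obtain f0 where f0: "bij_betw f0 {1..a} A"
    using finite_same_card_bij[of "{1..a}" A] fin assms by auto
  obtain f1 where f1: "bij_betw f1 {1..b} B2" "\<And>y. y \<in> {1..a} \<Longrightarrow> f1 y = f0 y"
    using bij_betw_extend[OF f0, of "{1..b}" B2] fin assms \<open>a \<le> b\<close> by auto
  have cB: "card (B1 \<union> B2) = 2 * b" using assms fin by (simp add: card_Un_disjoint)
  obtain f2 where f2: "bij_betw f2 {1..2*b} (B1 \<union> B2)" "\<And>y. y \<in> {1..b} \<Longrightarrow> f2 y = f1 y"
    using bij_betw_extend[OF f1(1), of "{1..2*b}" "B1 \<union> B2"] fin cB by auto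
  obtain f3 where f3: "bij_betw f3 {1..2*b+1} (insert x (B1 \<union> B2))" "\<And>y. y \<in> {1..2*b} \<Longrightarrow> f3 y = f2 y"
    using bij_betw_extend[OF f2(1), of "{1..2*b+1}" "insert x (B1 \<union> B2)"] fin cB assms by auto
  obtain p where p: "p permutes {1..n}" "\<And>y. y \<in> {1..2*b+1} \<Longrightarrow> p y = f3 y"
    using permutation_extend[OF f3(1), of "{1..n}"] assms by auto
  have "inj p" using p(1) by (rule permutes_inj)
  have eqs: "p y = f2 y" if "y \<in> {1..2*b}" for y using that p(2) f3(2) by auto
  have eq1: "p y = f1 y" if "y \<in> {1..b}" for y using that eqs f2(2) by auto
  have eq0: "p y = f0 y" if "y \<in> {1..a}" for y using that eq1 f1(2) \<open>a \<le> b\<close> by auto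
  have A: "p ` {1..a} = A" using eq0 f0 by (auto simp: bij_betw_def)
  have B2: "p ` {1..b} = B2" using eq1 f1 by (auto simp: bij_betw_def)
  have U: "p ` {1..2*b} = B1 \<union> B2" using eqs f2 by (auto simp: bij_betw_def)
  have V: "p ` {1..2*b+1} = insert x (B1 \<union> B2)" using p(2) f3 by (auto simp: bij_betw_def)
  have "{b+1..2*b} = {1..2*b} - {1..b}" by auto
  then have B1: "p ` {b+1..2*b} = B1" using U B2 image_set_diff[OF \<open>inj p\<close>] assms(9) by auto
  have "{2*b+1} = {1..2*b+1} - {1..2*b}" by auto
  then have "p ` {2*b+1} = {x}" using U V image_set_diff[OF \<open>inj p\<close>, of "{1..2*b+1}" "{1..2*b}"] assms(12) by auto
  then show ?thesis using zero[OF p(1)] A B1 B2 by simp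
qed

text \<open>The same passage from a tight average to every single configuration, now for Koenig
  triples.\<close>

lemma triple_tight:
  assumes F: "cross_partition_free F"
    and tight: "density n F a + density n F b + density n F (a + b) = 6"
    and "A \<subseteq> {1..n}" "B \<subseteq> {1..n}" "card A = a" "card B = b" "A \<inter> B = {}"
  shows "weight (\<lambda>i. A \<in> F i) + weight (\<lambda>i. B \<in> F i) + weight (\<lambda>i. A \<union> B \<in> F i) = 6"
proof -
  have fin: "finite A" "finite B" using assms by (meson finite_atLeastAtMost finite_subset)+
  have cAB: "card (A \<union> B) = a + b" using assms fin by (simp add: card_Un_disjoint)
  then have ab: "a + b \<le> n" using card_mono[of "{1..n}" "A \<union> B"] assms by auto
  let ?e = "\<lambda>p. 6 - weight (\<lambda>i. p ` {1..a} \<in> F i) - weight (\<lambda>i. p ` {a+1..a+b} \<in> F i)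
    - weight (\<lambda>i. p ` {1..a+b} \<in> F i)"
  have nonneg: "0 \<le> ?e p" if "p \<in> {p. p permutes {1..n}}" for p
  proof -
    have "inj p" using that by (auto dest: permutes_inj)
    have "{1..a} \<inter> {a+1..a+b} = {}" "{1..a+b} = {1..a} \<union> {a+1..a+b}" by auto
    then have "p ` {1..a} \<inter> p ` {a+1..a+b} = {}" "p ` {1..a+b} = p ` {1..a} \<union> p ` {a+1..a+b}"
      using \<open>inj p\<close> by (metis image_Int image_empty, metis image_Un)
    from koenig[OF cross_transversal_free[OF F this]] show ?thesis by simp
  qed
  have sub: "{1..a} \<subseteq> {1..n}" "{a+1..a+b} \<subseteq> {1..n}" "{1..a+b} \<subseteq> {1..n}" using ab by auto
  have "(\<Sum>p | p permutes {1..n}. ?e p) = fact n * (6 - density n F a - density n F b - density n F (a + b))"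
    by (simp only: sum_subtractf sub[THEN sum_permutations_weight] sum_constant
        card_permutations_interval card_atLeastAtMost) (simp add: algebra_simps)
  also have "\<dots> = 0" using tight by simp
  finally have zero: "?e p = 0" if "p permutes {1..n}" for p
    using that nonneg by (subst (asm) sum_nonneg_eq_0_iff) (auto simp: finite_permutations)
  obtain f0 where f0: "bij_betw f0 {1..a} A"
    using finite_same_card_bij[of "{1..a}" A] fin assms by auto
  obtain f1 where f1: "bij_betw f1 {1..a+b} (A \<union> B)" "\<And>y. y \<in> {1..a} \<Longrightarrow> f1 y = f0 y"
    using bij_betw_extend[OF f0, of "{1..a+b}" "A \<union> B"] fin cAB by auto
  obtain p where p: "p permutes {1..n}" "\<And>y. y \<in> {1..a+b} \<Longrightarrow> p y = f1 y"
    using permutation_extend[OF f1(1), of "{1..n}"] assms ab by auto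
  have "inj p" using p(1) by (rule permutes_inj)
  have A: "p ` {1..a} = A" using p f0 f1 by (auto simp: bij_betw_def)
  have AB: "p ` {1..a+b} = A \<union> B" using p f1 by (auto simp: bij_betw_def)
  have "{a+1..a+b} = {1..a+b} - {1..a}" by auto
  then have "p ` {a+1..a+b} = B" using A AB image_set_diff[OF \<open>inj p\<close>] assms(7) by auto
  then show ?thesis using zero[OF p(1)] A AB by simp
qed

section \<open>Binomial coefficients and the upper bound\<close>

lemma binomial_step: "k < n \<Longrightarrow> (k + 1) * (n choose (k + 1)) = (n - k) * (n choose k)"
  using Suc_times_binomial_add[of k "n - k - 1"] by (simp add: Suc_diff_Suc)

text \<open>The ratio \<open>(n - k) / (k + 1)\<close> of consecutive coefficients exceeds 2 in this
  range.\<close>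

lemma binomial_double_less:
  assumes "3 * k + 2 < n"
  shows "2 * (n choose k) < n choose (k + 1)"
proof -
  have "(2 * (k + 1)) * (n choose k) < (n - k) * (n choose k)"
    using assms by (intro mult_strict_right_mono) (auto simp: zero_less_binomial_iff)
  then have "(k + 1) * (2 * (n choose k)) < (n - k) * (n choose k)" by (simp only: ac_simps)
  also have "\<dots> = (k + 1) * (n choose (k + 1))" using binomial_step[of k n] assms by simp
  finally show ?thesis by (metis mult_less_cancel1)
qed

lemma sum_binomial_less:
  assumes "3 * k < n + 1"
  shows "(\<Sum>j<k. n choose j) < n choose k"
  using assms
proof (induction k)
  case (Suc k)
  then show ?case using binomial_double_less[of k n] by simp
qed simp

lemma binomial_middle:
  assumes "k \<le> j" "j + k \<le> n"
  shows "n choose k \<le> n choose j"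
proof (cases "2 * j \<le> n")
  case True
  then show ?thesis using assms by (intro binomial_mono)
next
  case False
  have "n choose j = n choose (n - j)" using assms by (intro binomial_symmetric) simp
  moreover have "n choose k \<le> n choose (n - j)" using False assms by (intro binomial_mono) auto
  ultimately show ?thesis by simp
qed

lemma image_add_lessThan: "(\<lambda>i. c + i) ` {..<k} = {c..<c + k}" for c k :: nat
  using image_add_atLeastLessThan[of c 0 k] by (simp add: lessThan_atLeast0 add.commute)

text \<open>The two cases are \<open>n = 3 * m + 2\<close> for \<open>a = m\<close> and \<open>n = 3 * m + 1\<close> for \<open>Suc a = m\<close>.\<close>

locale parameters =
  fixes n m a :: nat
  assumes m: "6 \<le> m" and n: "n = 2 * m + 2 + a" and a: "a = m \<or> Suc a = m"
begin

lemma a_ge: "5 \<le> a" "a \<le> m" "m \<le> Suc a" "a \<noteq> m \<Longrightarrow> m = Suc a"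
  using m a by auto

lemma binomial_complement: "i \<le> a \<Longrightarrow> n choose (2 * m + 2 + i) = n choose (a - i)"
  using binomial_symmetric[of "2 * m + 2 + i" n] n by simp

lemma binomial_double: "k < a \<Longrightarrow> 2 * (n choose k) < n choose (k + 1)"
  using binomial_double_less[of k n] n a_ge by simp

lemma sum_binomial_below: "k \<le> a \<Longrightarrow> (\<Sum>j<k. n choose j) < n choose k"
  using sum_binomial_less[of k n] n a_ge by simp

lemma binomial_near_a: "2 * (n choose (a - 1)) < n choose a" "2 * (n choose (a - 2)) < n choose (a - 1)"
proof -
  have "a = (a - 1) + 1" "a - 1 = (a - 2) + 1" "a - 1 < a" "a - 2 < a" using a_ge by auto
  then show "2 * (n choose (a - 1)) < n choose a" "2 * (n choose (a - 2)) < n choose (a - 1)"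
    using binomial_double by metis+
qed

text \<open>The right-hand side is the total charge on layer \<open>m + 1\<close>: twice
  \<open>n choose a\<close> from the local inequality and, if \<open>a \<noteq> m\<close>,
  \<open>n choose m\<close> from the sizes \<open>m\<close>, \<open>m + 1\<close>,
  \<open>2 * m + 1\<close>. Nothing is left over.\<close>

lemma binomial_layer_m1: "n choose (m + 1) = 2 * (n choose a) + (if a = m then 0 else n choose m)"
proof (cases "a = m")
  case True
  then have "(m + 1) * (n choose (m + 1)) = (m + 1) * (2 * (n choose a))"
    using binomial_step[of m n] n by simp
  then have "n choose (m + 1) = 2 * (n choose a)" by (subst (asm) nat_mult_eq_cancel1) auto
  then show ?thesis using True by simp
next
  case False
  then have m: "m = a + 1" "n = 3 * a + 4" using a n by auto
  have "(a + 1) * (n choose (a + 1)) = 2 * (a + 2) * (n choose a)"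
    using binomial_step[of a n] m(2) by (simp add: algebra_simps)
  moreover have "(a + 2) * (n choose (a + 2)) = (2 * a + 3) * (n choose (a + 1))"
    using binomial_step[of "a + 1" n] m by simp
  ultimately have "(a + 2) * (n choose (a + 2)) = (a + 2) * (2 * (n choose a) + (n choose (a + 1)))"
    by (simp add: algebra_simps)
  then have "n choose (a + 2) = 2 * (n choose a) + (n choose (a + 1))"
    by (subst (asm) nat_mult_eq_cancel1) auto
  then show ?thesis using m by simp
qed

lemma binomial_middle_layers: "m + 1 \<le> k \<Longrightarrow> k \<le> a + m + 1 \<Longrightarrow> n choose (m + 1) \<le> n choose k"
  using binomial_middle[of "m + 1" k n] n by simp

text \<open>The charges on layer \<open>m + 2\<close>, the most heavily used one, with one unit to
  spare. If \<open>a = m\<close>, the local inequality hits this layer twice, since then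
  \<open>2 * m + 2 - a = m + 2\<close>.\<close>

lemma binomial_layer_m2:
  "(n choose a) + (\<Sum>j<a - 1. n choose j) + (if a = m then n choose a else 0)
     + (n choose (a - 1)) + (n choose (a - 2)) + 1 \<le> n choose (m + 2)"
proof (cases "a = m")
  case False
  have "(\<Sum>j<a - 1. n choose j) < n choose (a - 1)" using sum_binomial_below[of "a - 1"] by simp
  then have "(n choose a) + (\<Sum>j<a - 1. n choose j) + (n choose (a - 1)) + (n choose (a - 2)) + 1
      \<le> 2 * (n choose a) + (n choose (a - 1))" using binomial_near_a by linarith
  also have "\<dots> \<le> n choose (m + 1)"
    using binomial_layer_m1 False a_ge(2) binomial_mono[of "a - 1" m n] n by auto
  also have "\<dots> \<le> n choose (m + 2)" using binomial_middle_layers[of "m + 2"] a_ge by simp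
  finally show ?thesis using False by simp
next
  case True
  have s: "(\<Sum>j<a - 1. n choose j) + 1 \<le> n choose (a - 1)" using sum_binomial_below[of "a - 1"] by simp
  obtain l where l: "m = l + 6" using m by (metis add.commute le_Suc_ex)
  have m1: "n choose (m + 1) = 2 * (n choose m)" using binomial_layer_m1 True by simp
  have u: "(m + 2) * (n choose (m + 2)) = (4 * m + 2) * (n choose m)"
    using binomial_step[of "m + 1" n] n True m1 by simp
  have "m * (n choose m) = (2 * m + 3) * (n choose (m - 1))"
    using binomial_step[of "m - 1" n] n True l by (simp add: ac_simps)
  then have v: "2 * m * (n choose m) = 2 * (2 * m + 3) * (n choose (m - 1))" by (simp only: mult.assoc)
  \<comment> \<open>By \<open>s\<close> and the doubling estimate, twice the left-hand side of the
    claim is at most \<open>4 * (n choose m) + 5 * (n choose (m - 1))\<close>. Multiplying through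
    expresses everything by \<open>n choose m\<close>; with \<open>m = l + 6\<close> the polynomial
    inequality holds coefficientwise.\<close>
  have "2 * (2 * m + 3) * (m + 2) * (4 * (n choose m) + 5 * (n choose (m - 1)))
      = (m + 2) * (8 * (2 * m + 3) * (n choose m) + 5 * (2 * (2 * m + 3) * (n choose (m - 1))))"
    by (simp add: algebra_simps)
  also have "\<dots> = (m + 2) * (26 * m + 24) * (n choose m)"
    unfolding v[symmetric] by (simp add: algebra_simps)
  also have "\<dots> \<le> 4 * (2 * m + 3) * (4 * m + 2) * (n choose m)"
    by (intro mult_right_mono) (simp_all add: l algebra_simps)
  also have "\<dots> = 2 * (2 * m + 3) * (m + 2) * (2 * (n choose (m + 2)))"
    using arg_cong[OF u, of "\<lambda>x. 4 * (2 * m + 3) * x"] by (simp add: algebra_simps)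
  finally have "4 * (n choose m) + 5 * (n choose (m - 1)) \<le> 2 * (n choose (m + 2))"
    by (subst (asm) mult_le_cancel1) simp
  then show ?thesis using s binomial_near_a(2) True by simp
qed

text \<open>Linear programming on the densities: outer layers are paid for by deficits
  \<open>?g\<close> of inner ones. The local inequality covers \<open>a\<close>,
  \<open>2 * m + 2\<close>, \<open>2 * m + 3\<close>, a triple covers \<open>m\<close> if
  \<open>a \<noteq> m\<close>, and triples of middle layers cover the rest. The terms added on the
  left are the slacks that equality will force to vanish.\<close>

lemma density_sum_bound:
  fixes f :: "nat \<Rightarrow> real"
  assumes f0: "\<And>k. 0 \<le> f k" and f3: "\<And>k. f k \<le> 3"
    and triple: "\<And>p q. p + q \<le> n \<Longrightarrow> f p + f q + f (p + q) \<le> 6"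
  shows "(\<Sum>k\<le>n. (n choose k) * f k)
      + (n choose a) * (2 * (3 - f (m + 1)) + (3 - f (a + m + 1)) + (3 - f (2 * m + 2 - a)) + (3 - f (m + 2))
          - f a - f (2 * m + 2) - f (2 * m + 3) / 2)
      + (if a = m then 0 else (n choose m) * (6 - f (m + 1) - f (2 * m + 1) - f m))
      + (\<Sum>i<a. 3 - f (m + 2 + i))
    \<le> 3 * (\<Sum>k = m + 1..2 * m + 1. n choose k)"
proof -
  let ?C = "\<lambda>k. real (n choose k)" and ?g = "\<lambda>k. 3 - f k"
  have g: "0 \<le> ?g k" for k using f3 by simp
  let ?G = "\<Sum>i<a-1. ?g (m + 2 + i)" and ?S = "\<lambda>k. \<Sum>j<k. ?C j"
  obtain a' where a': "a = Suc a'" using a_ge(1) by (cases a) auto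
  \<comment> \<open>With \<open>a' = a - 1\<close>, the sizes \<open>a' - i\<close> and
    \<open>m + 2 + i\<close> add up to \<open>a + m + 1\<close> for every \<open>i\<close>.\<close>
  have low1: "?C (a' - i) * f (a' - i) \<le> ?C (a' - i) * (?g (m + 2 + i) + ?g (a + m + 1))" if "i < a" for i
    using triple[of "a' - i" "m + 2 + i"] that a' n
    by (intro mult_left_mono) auto
  have "(\<Sum>j<a. ?C j * f j) = (\<Sum>i<a. ?C (a' - i) * f (a' - i))"
    unfolding a' by (subst sum.nat_diff_reindex[symmetric]) simp
  also have "\<dots> \<le> (\<Sum>i<a. ?C (a' - i) * (?g (m + 2 + i) + ?g (a + m + 1)))"
    using low1 by (intro sum_mono) simp
  also have "\<dots> = (\<Sum>i<a. ?C (a' - i) * ?g (m + 2 + i)) + (\<Sum>i<a. ?C (a' - i)) * ?g (a + m + 1)"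
    by (simp only: distrib_left sum.distrib sum_distrib_right)
  also have "(\<Sum>i<a. ?C (a' - i)) = ?S a"
    unfolding a' by (subst sum.nat_diff_reindex[symmetric]) simp
  \<comment> \<open>The summand \<open>i = a'\<close> has coefficient \<open>n choose 0\<close> and
    belongs to layer \<open>a + m + 1\<close>, so it is split off.\<close>
  also have "(\<Sum>i<a. ?C (a' - i) * ?g (m + 2 + i)) = (\<Sum>i<a'. ?C (a' - i) * ?g (m + 2 + i)) + ?g (a + m + 1)"
    unfolding a' by (simp add: add.commute)
  also have "(\<Sum>i<a'. ?C (a' - i) * ?g (m + 2 + i)) \<le> (\<Sum>i<a'. ?C a' * ?g (m + 2 + i))"
    using binomial_mono[of _ a' n] g n a' a_ge(2)
    by (intro sum_mono mult_right_mono) auto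
  finally have low: "(\<Sum>j<a. ?C j * f j) \<le> ?C (a - 1) * ?G + ?g (a + m + 1) + ?S a * ?g (a + m + 1)"
    by (simp add: sum_distrib_left a')
  obtain b where b: "a' = Suc b" using a_ge(1) a' by (cases a') auto
  have idx: "a - 1 = a'" "a - 2 = b" using a' b by auto
  \<comment> \<open>The layer \<open>2 * m + 4 + i\<close> is charged to \<open>m + 2\<close> and
    \<open>m + 2 + i\<close>.\<close>
  have high1: "?C (b - i) * f (2 * m + 4 + i) \<le> ?C (b - i) * (?g (m + 2) + ?g (m + 2 + i))" if "i < a'" for i
  proof (intro mult_left_mono)
    have eq: "m + 2 + (m + 2 + i) = 2 * m + 4 + i" "2 * m + 4 + i \<le> n" using that a' n by auto
    have "f (m + 2) + f (m + 2 + i) + f (2 * m + 4 + i) \<le> 6"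
      using triple[of "m + 2" "m + 2 + i", unfolded eq(1)] eq(2) by blast
    then show "f (2 * m + 4 + i) \<le> ?g (m + 2) + ?g (m + 2 + i)" by simp
  qed simp
  have "{2 * m + 4..n} = (\<lambda>i. 2 * m + 4 + i) ` {..<a'}"
  proof -
    have "n = 2 * m + 4 + b" using n a' b by simp
    then show ?thesis unfolding image_add_lessThan b by auto
  qed
  then have "(\<Sum>k = 2 * m + 4..n. ?C k * f k) = (\<Sum>i<a'. ?C (2 * m + 4 + i) * f (2 * m + 4 + i))"
    by (simp add: sum.reindex inj_on_def)
  also have "\<dots> = (\<Sum>i<a'. ?C (b - i) * f (2 * m + 4 + i))"
  proof (rule sum.cong[OF refl])
    fix i assume "i \<in> {..<a'}"
    then have "n choose (2 * m + 2 + (i + 2)) = n choose (a - (i + 2))"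
      using a' b by (intro binomial_complement) auto
    moreover have "2 * m + 2 + (i + 2) = 2 * m + 4 + i" "a - (i + 2) = b - i" using a' b by auto
    ultimately have "n choose (2 * m + 4 + i) = n choose (b - i)" by (simp only:)
    then show "?C (2 * m + 4 + i) * f (2 * m + 4 + i) = ?C (b - i) * f (2 * m + 4 + i)"
      by (simp only:)
  qed
  also have "\<dots> \<le> (\<Sum>i<a'. ?C (b - i) * (?g (m + 2) + ?g (m + 2 + i)))"
    using high1 by (intro sum_mono) simp
  also have "\<dots> = (\<Sum>i<a'. ?C (b - i)) * ?g (m + 2) + (\<Sum>i<a'. ?C (b - i) * ?g (m + 2 + i))"
    by (simp only: distrib_left sum.distrib sum_distrib_right)
  also have "(\<Sum>i<a'. ?C (b - i)) = ?S a'"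
    unfolding b by (subst sum.nat_diff_reindex[symmetric]) simp
  also have "(\<Sum>i<a'. ?C (b - i) * ?g (m + 2 + i)) \<le> (\<Sum>i<a'. ?C b * ?g (m + 2 + i))"
    using binomial_mono[of _ b n] g n a' b a_ge(2)
    by (intro sum_mono mult_right_mono) auto
  finally have high: "(\<Sum>k = 2 * m + 4..n. ?C k * f k) \<le> ?S (a - 1) * ?g (m + 2) + ?C (a - 2) * ?G"
    unfolding idx by (simp only: sum_distrib_left)

  \<comment> \<open>Everything charged to layer \<open>m + 2 + i\<close>: the local inequality hits
    \<open>i = 0\<close> and \<open>i = m - a\<close>, the common part of the high layers hits
    \<open>i = 0\<close>, then come the low and the high layers, and 1 is the slack that is
    kept.\<close>
  have coeff: "(if i = 0 then ?C a + ?S (a - 1) else 0) + (if i = m - a then ?C a else 0)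
      + ?C (a - 1) + ?C (a - 2) + 1 \<le> ?C (m + 2 + i)" if "i < a - 1" for i
  proof -
    have gen: "?C a + ?C (a - 1) + ?C (a - 2) + 1 \<le> ?C (m + 2 + i)"
    proof -
      have "(n choose a) + (n choose (a - 1)) + (n choose (a - 2)) + 1 \<le> 2 * (n choose a)"
        using binomial_near_a by linarith
      also have "\<dots> \<le> n choose (m + 1)" using binomial_layer_m1 by simp
      also have "\<dots> \<le> n choose (m + 2 + i)" using that by (intro binomial_middle_layers) auto
      finally show ?thesis by linarith
    qed
    show ?thesis
    proof (cases "i = 0")
      case True
      have "real ((n choose a) + (\<Sum>j<a - 1. n choose j) + (if a = m then n choose a else 0)
         + (n choose (a - 1)) + (n choose (a - 2)) + 1) \<le> real (n choose (m + 2))"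
        using binomial_layer_m2 unfolding of_nat_le_iff .
      moreover have "m - a = 0 \<longleftrightarrow> a = m" using a by auto
      ultimately show ?thesis using True by (simp split: if_splits)
    next
      case False
      then show ?thesis using gen by (auto split: if_splits)
    qed
  qed
  let ?M = "\<Sum>i<a-1. ?C (m + 2 + i) * ?g (m + 2 + i)"
  have "(\<Sum>i<a-1. ((if i = 0 then ?C a + ?S (a - 1) else 0) + (if i = m - a then ?C a else 0)
      + ?C (a - 1) + ?C (a - 2) + 1) * ?g (m + 2 + i)) \<le> ?M"
    using coeff g by (intro sum_mono mult_right_mono) auto
  moreover have "(\<Sum>i<a-1. ((if i = 0 then ?C a + ?S (a - 1) else 0) + (if i = m - a then ?C a else 0)
      + ?C (a - 1) + ?C (a - 2) + 1) * ?g (m + 2 + i))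
    = (?C a + ?S (a - 1)) * ?g (m + 2) + ?C a * ?g (2 * m + 2 - a) + (?C (a - 1) + ?C (a - 2) + 1) * ?G"
  proof -
    have ind: "(\<Sum>i<a-1. (if i = j then c else 0) * ?g (m + 2 + i)) = c * ?g (m + 2 + j)"
      if "j < a - 1" for j and c :: real
    proof -
      have "(\<Sum>i<a-1. (if i = j then c else 0) * ?g (m + 2 + i))
        = (\<Sum>i<a-1. if i = j then c * ?g (m + 2 + j) else 0)" by (intro sum.cong) auto
      then show ?thesis using that by simp
    qed
    have eqs: "0 < a - 1" "m - a < a - 1" "m + 2 + (m - a) = 2 * m + 2 - a" using a_ge by auto
    show ?thesis
      by (simp only: distrib_right sum.distrib sum_distrib_left ind[OF eqs(1), unfolded add_0_right]
          ind[OF eqs(2), unfolded eqs(3)] mult_1)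
  qed
  ultimately have mid: "(?C a + ?S (a - 1)) * ?g (m + 2) + ?C a * ?g (2 * m + 2 - a)
     + (?C (a - 1) + ?C (a - 2) + 1) * ?G \<le> ?M" by simp
  \<comment> \<open>Layer \<open>a + m + 1\<close> bears the local inequality, the common part of
    all low layers, and 2 further units: the split-off summand and the slack that is kept.\<close>
  have top: "(?C a + ?S a + 2) * ?g (a + m + 1) \<le> ?C (a + m + 1) * ?g (a + m + 1)"
  proof (intro mult_right_mono g)
    have "(\<Sum>j<a. n choose j) = (\<Sum>j<a'. n choose j) + (n choose a')" using a' by simp
    also have "\<dots> < 2 * (n choose a')" using sum_binomial_below[of a'] a' by simp
    finally have "(n choose a) + (\<Sum>j<a. n choose j) + 2 \<le> 2 * (n choose a)"
      using binomial_near_a(1) a' by simp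
    also have "\<dots> \<le> n choose (m + 1)" using binomial_layer_m1 by simp
    also have "\<dots> \<le> n choose (a + m + 1)" by (intro binomial_middle_layers) auto
    finally have "real ((n choose a) + (\<Sum>j<a. n choose j) + 2) \<le> real (n choose (a + m + 1))"
      unfolding of_nat_le_iff .
    then show "?C a + ?S a + 2 \<le> ?C (a + m + 1)" by simp
  qed
  \<comment> \<open>Layer \<open>2 * m + 3\<close> has at most half the size of layer
    \<open>a\<close>, which matches its coefficient 1/2 in the local term.\<close>
  have upper: "?C (2 * m + 3) * f (2 * m + 3) \<le> ?C a * (f (2 * m + 3) / 2)"
  proof -
    have "?C (2 * m + 3) = ?C (a - 1)" using binomial_complement[of 1] a_ge by (simp add: numeral_3_eq_3)
    moreover have "2 * ?C (a - 1) \<le> ?C a" using binomial_near_a(1) by linarith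
    ultimately have "?C (2 * m + 3) \<le> ?C a / 2" by simp
    from mult_right_mono[OF this f0[of "2 * m + 3"]] show ?thesis by simp
  qed
  have C2: "?C (2 * m + 2) = ?C a" using binomial_complement[of 0] by simp

  have inner: "(\<Sum>k = m + 1..2 * m + 1. ?C k * ?g k)
    = ?C (m + 1) * ?g (m + 1) + ?M + ?C (a + m + 1) * ?g (a + m + 1)
      + (if a = m then 0 else ?C (2 * m + 1) * ?g (2 * m + 1))"
  proof -
    \<comment> \<open>\<open>a + m + 1\<close> is the last layer \<open>2 * m + 1\<close> if
      \<open>a = m\<close>; otherwise it is \<open>2 * m\<close> and one more layer follows.\<close>
    have "{m + 1..2 * m + 1} = insert (m + 1) ((\<lambda>i. m + 2 + i) ` {..<a-1} \<union>
        ({a + m + 1} \<union> (if a = m then {} else {2 * m + 1})))" (is "_ = insert _ (?I \<union> ?J)")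
    proof -
      have "?I = {m + 2..a + m}"
        unfolding image_add_lessThan using a_ge by auto
      then show ?thesis using a_ge by auto
    qed
    moreover have "m + 1 \<notin> ?I \<union> ?J" "?I \<inter> ?J = {}" "finite ?I" "finite ?J" using a_ge by auto
    moreover have "sum (\<lambda>k. ?C k * ?g k) ?I = ?M" by (simp add: sum.reindex inj_on_def)
    moreover have "sum (\<lambda>k. ?C k * ?g k) ?J = ?C (a + m + 1) * ?g (a + m + 1)
      + (if a = m then 0 else ?C (2 * m + 1) * ?g (2 * m + 1))" using a_ge by auto
    ultimately show ?thesis by (simp add: sum.union_disjoint)
  qed
  have split: "(\<Sum>k\<le>n. ?C k * f k) = (\<Sum>j<a. ?C j * f j) + ?C a * f a + (if a = m then 0 else ?C m * f m)
     + (\<Sum>k = m + 1..2 * m + 1. ?C k * f k) + ?C (2 * m + 2) * f (2 * m + 2)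
     + ?C (2 * m + 3) * f (2 * m + 3) + (\<Sum>k = 2 * m + 4..n. ?C k * f k)"
  proof -
    define h where "h = (\<lambda>k. ?C k * f k)"
    define Y where "Y = {a} \<union> (if a = m then {} else {m})"
    define W where "W = {2 * m + 2, 2 * m + 3} \<union> {2 * m + 4..n}"
    have "{..n} = ({..<a} \<union> Y \<union> {m + 1..2 * m + 1}) \<union> W"
      unfolding Y_def W_def using a_ge n by auto
    moreover have "({..<a} \<union> Y \<union> {m + 1..2 * m + 1}) \<inter> W = {}" "({..<a} \<union> Y) \<inter> {m + 1..2 * m + 1} = {}"
      "{..<a} \<inter> Y = {}" "finite Y" "finite W"
      unfolding Y_def W_def using a_ge by auto
    ultimately have "sum h {..n} = sum h {..<a} + sum h Y + sum h {m + 1..2 * m + 1} + sum h W"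
      by (simp add: sum.union_disjoint)
    moreover have "sum h Y = h a + (if a = m then 0 else h m)" unfolding Y_def by auto
    moreover have "sum h W = h (2 * m + 2) + h (2 * m + 3) + sum h {2 * m + 4..n}"
      unfolding W_def by simp
    ultimately show ?thesis unfolding h_def by simp
  qed
  have G: "(\<Sum>i<a. ?g (m + 2 + i)) = ?G + ?g (a + m + 1)"
    unfolding a' by (simp add: add.commute)
  have "?C (m + 1) * ?g (m + 1) = 2 * ?C a * ?g (m + 1) + (if a = m then 0 else ?C m * ?g (m + 1))"
    using binomial_layer_m1 by (simp add: algebra_simps)
  moreover have "?C (2 * m + 1) = ?C m" if "a \<noteq> m"
    using that binomial_symmetric[of m n] n a by (auto simp: numeral_2_eq_2)
  moreover have "(\<Sum>k\<in>X. ?C k * f k) = 3 * (\<Sum>k\<in>X. ?C k) - (\<Sum>k\<in>X. ?C k * ?g k)" for X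
    by (simp add: sum_distrib_left sum_subtractf right_diff_distrib mult.commute)
  note this[of "{m + 1..2 * m + 1}"]
  ultimately show ?thesis
    unfolding split G using inner low high mid top upper C2
    by (cases "a = m") (simp_all add: algebra_simps)
qed

end

section \<open>The case of equality\<close>

text \<open>Subsets of fixed size are connected by exchanges of one element: an exchange towards
  \<open>T\<close> decreases \<open>card (T - S)\<close>.\<close>

lemma exchange_connected:
  fixes P :: "'a set \<Rightarrow> bool"
  assumes U: "finite U" and B: "B \<subseteq> U" "P B" and T: "T \<subseteq> U" "card T = card B"
    and step: "\<And>S x y. S \<subseteq> U \<Longrightarrow> card S = card B \<Longrightarrow> P S \<Longrightarrow> x \<in> S \<Longrightarrow> y \<in> U - S \<Longrightarrow> P (insert y (S - {x}))"
  shows "P T"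
proof -
  have "P T" if "S \<subseteq> U" "card S = card B" "P S" for S
    using that
  proof (induction "card (T - S)" arbitrary: S rule: less_induct)
    case less
    have fin: "finite S" "finite T" using U T less.prems by (auto intro: finite_subset)
    show ?case
    proof (cases "T \<subseteq> S")
      case True
      then have "T = S" using fin T less.prems by (simp add: card_subset_eq)
      then show ?thesis using less.prems by simp
    next
      case False
      then obtain y where y: "y \<in> T" "y \<notin> S" by auto
      have "\<not> S \<subseteq> T" using False fin T less.prems by (metis card_subset_eq order_refl)
      then obtain x where x: "x \<in> S" "x \<notin> T" by auto
      let ?S = "insert y (S - {x})"
      have "T - ?S \<subset> T - S" using x y by auto
      then have "card (T - ?S) < card (T - S)" using fin by (intro psubset_card_mono) auto
      moreover have "?S \<subseteq> U" "P ?S" using x y T less.prems step by auto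
      moreover have "card ?S = card B"
        using fin x y less.prems by (simp add: card_Diff_singleton card_gt_0_iff) (metis Suc_pred card_gt_0_iff empty_iff)
      ultimately show ?thesis using less.hyps by blast
    qed
  qed
  then show ?thesis using B by blast
qed

lemma sum_card_families:
  assumes "\<forall>i\<in>{1, 2, 3}. F i \<subseteq> Pow {1..n}"
  shows "real (card (F 1) + card (F 2) + card (F 3)) = (\<Sum>k\<le>n. (n choose k) * density n F k)"
proof -
  have c: "Pow {1..n} \<inter> F i = F i" if "i \<in> {1, 2, 3}" for i
    using assms that by auto
  have "(\<Sum>k\<le>n. (n choose k) * density n F k) = (\<Sum>k\<le>n. \<Sum>S\<in>{S \<in> Pow {1..n}. card S = k}. weight (\<lambda>i. S \<in> F i))"
    by (intro sum.cong) (auto simp: density_mult level_def)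
  also have "\<dots> = (\<Sum>S\<in>Pow {1..n}. weight (\<lambda>i. S \<in> F i))"
  proof (rule sum.group)
    show "card ` Pow {1..n} \<subseteq> {..n}" using card_mono[of "{1..n}"] by auto
  qed auto
  also have "\<dots> = real (card (F 1) + card (F 2) + card (F 3))"
    unfolding weight_eq by (simp add: sum.distrib c del: One_nat_def)
  finally show ?thesis by simp
qed

section \<open>The upper bound for the families\<close>

locale families = parameters +
  fixes F :: "nat \<Rightarrow> nat set set"
  assumes sub: "\<forall>i\<in>{1, 2, 3}. F i \<subseteq> Pow {1..n}" and cpf: "cross_partition_free F"
begin

abbreviation f :: "nat \<Rightarrow> real" where "f \<equiv> density n F"
abbreviation w :: "nat set \<Rightarrow> real" where "w S \<equiv> weight (\<lambda>i. S \<in> F i)"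

text \<open>This is \<open>density_local\<close> with \<open>b = m + 1\<close>, divided by
  2.\<close>

lemma local_slack:
  "0 \<le> 2 * (3 - f (m + 1)) + (3 - f (a + m + 1)) + (3 - f (2 * m + 2 - a)) + (3 - f (m + 2))
        - f a - f (2 * m + 2) - f (2 * m + 3) / 2"
proof -
  have eqs: "a + (m + 1) = a + m + 1" "2 * (m + 1) = 2 * m + 2" "2 * m + 2 + 1 = 2 * m + 3" "m + 1 + 1 = m + 2" by auto
  have "a \<le> m + 1" "2 * (m + 1) + 1 \<le> n" using a_ge n by auto
  from density_local[OF cpf this, unfolded eqs] show ?thesis by simp
qed

lemma triple_slack: "a \<noteq> m \<Longrightarrow> 0 \<le> 6 - f (m + 1) - f (2 * m + 1) - f m"
  using density_triple[OF cpf, of m "m + 1" n] n a_ge by (simp add: mult_2)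

lemma card_bound: "card (F 1) + card (F 2) + card (F 3) \<le> 3 * (\<Sum>t = m + 1..2 * m + 1. n choose t)"
proof -
  have "0 \<le> (\<Sum>i<a. 3 - f (m + 2 + i))" by (intro sum_nonneg) (simp add: density_bounds)
  moreover note density_sum_bound[of f, OF density_bounds density_triple[OF cpf]]
  moreover have "0 \<le> (if a = m then 0 else (n choose m) * (6 - f (m + 1) - f (2 * m + 1) - f m))"
    using triple_slack by simp
  moreover note mult_nonneg_nonneg[OF of_nat_0_le_iff[of "n choose a"] local_slack]
  ultimately show ?thesis using sum_card_families[OF sub] by linarith
qed

end

section \<open>Layers forced by equality\<close>

locale extremal = families +
  assumes extremal: "card (F 1) + card (F 2) + card (F 3) = 3 * (\<Sum>t = m + 1..2 * m + 1. n choose t)"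
begin

text \<open>The three slacks in \<open>density_sum_bound\<close> are nonnegative, and equality
  leaves no room for them.\<close>

lemma tight:
  "(\<Sum>i<a. 3 - f (m + 2 + i)) = 0"
  "2 * (3 - f (m + 1)) + (3 - f (a + m + 1)) + (3 - f (2 * m + 2 - a)) + (3 - f (m + 2))
    - f a - f (2 * m + 2) - f (2 * m + 3) / 2 = 0" (is "?L = 0")
  "a \<noteq> m \<Longrightarrow> 6 - f (m + 1) - f (2 * m + 1) - f m = 0"
proof -
  let ?R = "6 - f (m + 1) - f (2 * m + 1) - f m"
  have 1: "0 \<le> (\<Sum>i<a. 3 - f (m + 2 + i))" by (intro sum_nonneg) (simp add: density_bounds)
  have 2: "0 \<le> (n choose a) * ?L" using local_slack by simp
  have 3: "0 \<le> (if a = m then 0 else (n choose m) * ?R)" using triple_slack by simp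
  have "(n choose a) * ?L + (if a = m then 0 else (n choose m) * ?R) + (\<Sum>i<a. 3 - f (m + 2 + i)) \<le> 0"
    using density_sum_bound[of f, OF density_bounds density_triple[OF cpf]] sum_card_families[OF sub]
      extremal by linarith
  then have "(\<Sum>i<a. 3 - f (m + 2 + i)) = 0" "(n choose a) * ?L = 0" "(if a = m then 0 else (n choose m) * ?R) = 0"
    using 1 2 3 by linarith+
  moreover have "n choose a \<noteq> 0" "n choose m \<noteq> 0" using n by auto
  ultimately show "(\<Sum>i<a. 3 - f (m + 2 + i)) = 0" "?L = 0" "a \<noteq> m \<Longrightarrow> ?R = 0" by auto
qed

lemma density_middle:
  assumes k: "m + 2 \<le> k" "k \<le> a + m + 1"
  shows "f k = 3"
proof -
  have "\<forall>i\<in>{..<a}. 3 - f (m + 2 + i) = 0"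
    using tight(1) by (subst (asm) sum_nonneg_eq_0_iff) (auto simp: density_bounds)
  moreover have "k - (m + 2) \<in> {..<a}" "m + 2 + (k - (m + 2)) = k" using k by auto
  ultimately show ?thesis by (metis right_minus_eq)
qed

lemma full_middle:
  "S \<subseteq> {1..n} \<Longrightarrow> m + 2 \<le> card S \<Longrightarrow> card S \<le> a + m + 1 \<Longrightarrow> full (\<lambda>i. S \<in> F i)"
  by (intro density_three[OF _ density_middle[of "card S"]]) (use n in \<open>auto simp: level_def\<close>)

text \<open>Together with a full layer \<open>a + m + 1 - card S\<close> such a set reaches the full
  layer \<open>a + m + 1\<close>; Koenig then leaves density 0.\<close>

lemma none_low:
  assumes "S \<subseteq> {1..n}" "card S < a"
  shows "none (\<lambda>i. S \<in> F i)"
proof (rule density_zero)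
  have "card S + (a + m + 1 - card S) \<le> n" "card S + (a + m + 1 - card S) = a + m + 1"
    using assms n by auto
  then have "f (card S) + f (a + m + 1 - card S) + f (a + m + 1) \<le> 6"
    using density_triple[OF cpf, of "card S" "a + m + 1 - card S" n] by simp
  moreover have "f (a + m + 1 - card S) = 3" "f (a + m + 1) = 3"
    using assms a_ge by (auto intro!: density_middle)
  ultimately show "f (card S) = 0" using density_bounds(1)[of n F "card S"] by linarith
qed (use assms n in \<open>auto simp: level_def\<close>)

text \<open>Here the size splits into \<open>m + 2\<close> and \<open>card S - (m + 2)\<close>, both
  sizes of full layers.\<close>

lemma none_high:
  assumes "S \<subseteq> {1..n}" "2 * m + 4 \<le> card S"
  shows "none (\<lambda>i. S \<in> F i)"
proof (rule density_zero)
  have c: "card S \<le> n" using assms card_mono[of "{1..n}" S] by simp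
  then have k: "m + 2 + (card S - (m + 2)) \<le> n" "m + 2 + (card S - (m + 2)) = card S"
    using assms by auto
  have "f (m + 2) + f (card S - (m + 2)) + f (card S) \<le> 6"
    using density_triple[OF cpf k(1), unfolded k(2)] .
  moreover have "f (m + 2) = 3" using a_ge by (intro density_middle) auto
  moreover have "f (card S - (m + 2)) = 3" using assms(2) c n by (intro density_middle) linarith+
  ultimately show "f (card S) = 0" using density_bounds(1)[of n F "card S"] by linarith
qed (use assms card_mono[of "{1..n}" S] in \<open>auto simp: level_def\<close>)

lemma excess_tight:
  assumes "B1 \<subseteq> {1..n}" "B2 \<subseteq> {1..n}" "x \<in> {1..n}" "card B1 = m + 1" "card B2 = m + 1"
    "B1 \<inter> B2 = {}" "A \<subseteq> B2" "card A = a" "x \<notin> B1 \<union> B2"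
  shows "2 * w A + 2 * w (B1 \<union> B2) + w (insert x (B1 \<union> B2)) + 2 * w B1 + 2 * w B2 = 12"
    "transversal_free (\<lambda>i. A \<in> F i) (\<lambda>i. B1 \<in> F i) (\<lambda>i. A \<union> B1 \<in> F i)"
    "transversal_free (\<lambda>i. A \<in> F i) (\<lambda>i. B1 \<union> B2 - A \<in> F i) (\<lambda>i. B1 \<union> B2 \<in> F i)"
    "full (\<lambda>i. A \<union> B1 \<in> F i)" "full (\<lambda>i. B1 \<union> B2 - A \<in> F i)"
    "full (\<lambda>i. insert x B1 \<in> F i)" "full (\<lambda>i. insert x B2 \<in> F i)"
proof -
  have fin: "finite A" "finite B1" "finite B2" using assms by (meson finite_atLeastAtMost finite_subset)+
  have c: "card (B1 \<union> B2) = 2 * m + 2" using assms fin by (simp add: card_Un_disjoint)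
  have c2: "card (A \<union> B1) = a + m + 1" using assms fin by (subst card_Un_disjoint) auto
  have c3: "card (B1 \<union> B2 - A) = 2 * m + 2 - a" using assms fin c by (subst card_Diff_subset) auto
  have c4: "card (insert x B1) = m + 2" "card (insert x B2) = m + 2" using assms fin by simp_all
  have s: "A \<union> B1 \<subseteq> {1..n}" "B1 \<union> B2 - A \<subseteq> {1..n}" "insert x B1 \<subseteq> {1..n}" "insert x B2 \<subseteq> {1..n}"
    using assms by auto
  show fulls: "full (\<lambda>i. A \<union> B1 \<in> F i)" "full (\<lambda>i. B1 \<union> B2 - A \<in> F i)"
    "full (\<lambda>i. insert x B1 \<in> F i)" "full (\<lambda>i. insert x B2 \<in> F i)"
    by (rule full_middle, fact s, use c2 c3 c4 a_ge in linarith, use c2 c3 c4 a_ge in linarith)+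
  have "excess F A B1 B2 x = 0"
  proof (rule excess_eq_0[where b = "m + 1" and a = a])
    have eqs: "a + (m + 1) = a + m + 1" "2 * (m + 1) = 2 * m + 2" "2 * m + 2 + 1 = 2 * m + 3" "m + 1 + 1 = m + 2" by auto
    show "2 * f a + 2 * f (2 * (m + 1)) + f (2 * (m + 1) + 1)
      = 4 * (3 - f (m + 1)) + 2 * (3 - f (a + (m + 1))) + 2 * (3 - f (2 * (m + 1) - a)) + 2 * (3 - f (m + 1 + 1))"
      unfolding eqs using tight(2) by simp
  qed (use assms cpf n a_ge in auto)
  then show "2 * w A + 2 * w (B1 \<union> B2) + w (insert x (B1 \<union> B2)) + 2 * w B1 + 2 * w B2 = 12"
    using fulls unfolding excess_def full_iff by simp
qed (use assms in \<open>auto intro!: cross_transversal_free[OF cpf]\<close>)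

lemma local_state:
  assumes "B1 \<subseteq> {1..n}" "B2 \<subseteq> {1..n}" "x \<in> {1..n}" "card B1 = m + 1" "card B2 = m + 1"
    "B1 \<inter> B2 = {}" "A \<subseteq> B2" "card A = a" "x \<notin> B1 \<union> B2"
  shows "none (\<lambda>i. A \<in> F i) \<and> none (\<lambda>i. insert x (B1 \<union> B2) \<in> F i) \<and>
    (full (\<lambda>i. B1 \<in> F i) \<and> full (\<lambda>i. B2 \<in> F i) \<and> none (\<lambda>i. B1 \<union> B2 \<in> F i) \<or>
     w B1 = 2 \<and> (\<forall>i\<in>{1, 2, 3}. (B2 \<in> F i) = (B1 \<in> F i) \<and> (B1 \<union> B2 \<in> F i) = (B1 \<in> F i)) \<or>
     full (\<lambda>i. B1 \<in> F i) \<and> none (\<lambda>i. B2 \<in> F i) \<and> full (\<lambda>i. B1 \<union> B2 \<in> F i) \<or>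
     none (\<lambda>i. B1 \<in> F i) \<and> full (\<lambda>i. B2 \<in> F i) \<and> full (\<lambda>i. B1 \<union> B2 \<in> F i))"
proof -
  \<comment> \<open>The mirror configuration: an \<open>a\<close>-set inside \<open>B1\<close>, with
    \<open>B1\<close> and \<open>B2\<close> interchanged.\<close>
  obtain A' where A': "A' \<subseteq> B1" "card A' = a"
    using obtain_subset_with_card_n[of a B1] assms(4) a_ge by auto
  note 1 = excess_tight[OF assms]
  have "B2 \<inter> B1 = {}" "x \<notin> B2 \<union> B1" "B2 \<union> B1 = B1 \<union> B2" using assms by auto
  note 2 = excess_tight[OF assms(2,1,3,5,4) \<open>B2 \<inter> B1 = {}\<close> A' \<open>x \<notin> B2 \<union> B1\<close>, unfolded \<open>B2 \<union> B1 = B1 \<union> B2\<close>]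
  show ?thesis
  proof (rule local_equality[OF 1(2,3) _ _ _ 2(2,3) 1(4,5) 1(7,6) 2(4,5) 1(1)])
    show "2 * w A' + 2 * w (B1 \<union> B2) + w (insert x (B1 \<union> B2)) + 2 * w B1 + 2 * w B2 = 12"
      using 2(1) by simp
  qed (use assms in \<open>auto intro!: cross_transversal_free[OF cpf]\<close>)
qed

lemma middle_state:
  assumes "B1 \<subseteq> {1..n}" "B2 \<subseteq> {1..n}" "card B1 = m + 1" "card B2 = m + 1" "B1 \<inter> B2 = {}"
  shows "full (\<lambda>i. B1 \<in> F i) \<and> full (\<lambda>i. B2 \<in> F i) \<and> none (\<lambda>i. B1 \<union> B2 \<in> F i) \<or>
     w B1 = 2 \<and> (\<forall>i\<in>{1, 2, 3}. (B2 \<in> F i) = (B1 \<in> F i) \<and> (B1 \<union> B2 \<in> F i) = (B1 \<in> F i)) \<or>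
     full (\<lambda>i. B1 \<in> F i) \<and> none (\<lambda>i. B2 \<in> F i) \<and> full (\<lambda>i. B1 \<union> B2 \<in> F i) \<or>
     none (\<lambda>i. B1 \<in> F i) \<and> full (\<lambda>i. B2 \<in> F i) \<and> full (\<lambda>i. B1 \<union> B2 \<in> F i)"
proof -
  have fin: "finite B1" "finite B2" using assms by (meson finite_atLeastAtMost finite_subset)+
  obtain A where A: "A \<subseteq> B2" "card A = a"
    using obtain_subset_with_card_n[of a B2] assms a_ge by auto
  have "card (B1 \<union> B2) = 2 * m + 2" using assms fin by (simp add: card_Un_disjoint)
  then have "B1 \<union> B2 \<noteq> {1..n}" using n a_ge by auto
  moreover have "B1 \<union> B2 \<subseteq> {1..n}" using assms by simp
  ultimately obtain x where "x \<in> {1..n}" "x \<notin> B1 \<union> B2" by blast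
  from local_state[OF assms(1,2) this(1) assms(3,4,5) A this(2)] show ?thesis by blast
qed

lemma none_a:
  assumes "A \<subseteq> {1..n}" "card A = a"
  shows "none (\<lambda>i. A \<in> F i)"
proof -
  obtain B2 where B2: "A \<subseteq> B2" "B2 \<subseteq> {1..n}" "card B2 = m + 1"
    using exists_subset_between[of A "m + 1" "{1..n}"] assms n a_ge by auto
  have fin: "finite B2" using B2 by (meson finite_atLeastAtMost finite_subset)
  have "m + 1 \<le> card ({1..n} - B2)" using B2 fin n by (subst card_Diff_subset) auto
  then obtain B1 where B1: "B1 \<subseteq> {1..n} - B2" "card B1 = m + 1"
    using obtain_subset_with_card_n by metis
  then have fin1: "finite B1" by (meson finite_atLeastAtMost finite_Diff finite_subset)
  have "card (B1 \<union> B2) = 2 * m + 2" using B1 B2 fin fin1 by (subst card_Un_disjoint) auto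
  then have "B1 \<union> B2 \<noteq> {1..n}" using n a_ge by auto
  moreover have "B1 \<union> B2 \<subseteq> {1..n}" using B1 B2 by auto
  ultimately obtain x where "x \<in> {1..n}" "x \<notin> B1 \<union> B2" by blast
  then show ?thesis using local_state[of B1 B2 x A] B1 B2 assms by auto
qed

lemma none_2m3:
  assumes "D \<subseteq> {1..n}" "card D = 2 * m + 3"
  shows "none (\<lambda>i. D \<in> F i)"
proof -
  have "m + 1 \<le> card D" using assms by simp
  then obtain B1 where B1: "B1 \<subseteq> D" "card B1 = m + 1" by (metis obtain_subset_with_card_n)
  have fin: "finite D" "finite B1" using assms B1 by (meson finite_atLeastAtMost finite_subset)+
  have c: "card (D - B1) = m + 2" using B1 assms fin by (subst card_Diff_subset) auto
  then have "m + 1 \<le> card (D - B1)" by simp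
  then obtain B2 where B2: "B2 \<subseteq> D - B1" "card B2 = m + 1" by (metis obtain_subset_with_card_n)
  have fin2: "finite B2" using B2 fin by (meson finite_Diff finite_subset)
  have "card (D - B1 - B2) = 1" using c B2 fin2 by (subst card_Diff_subset) auto
  then obtain x where "D - B1 - B2 = {x}" by (auto simp: card_1_singleton_iff)
  then have x: "D = insert x (B1 \<union> B2)" "x \<in> {1..n}" "x \<notin> B1 \<union> B2" using B1 B2 assms by auto
  obtain A where A: "A \<subseteq> B2" "card A = a"
    using obtain_subset_with_card_n[of a B2] B2 a_ge by auto
  show ?thesis using local_state[of B1 B2 x A] x A B1 B2 assms by auto
qed

end

text \<open>Both nonempty rows must sit in one and the same column.\<close>

lemma weight_exclusive:
  assumes "\<forall>i\<in>{1, 2, 3}. \<forall>j\<in>{1, 2, 3}. i \<noteq> j \<longrightarrow> \<not> (P i \<and> Q j)"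
    and "weight P \<noteq> 0" "weight Q \<noteq> 0"
  shows "weight P + weight Q \<le> 2"
proof -
  have *: "\<not> (P i \<and> Q j)" if "i \<noteq> j" "i \<in> {1, 2, 3}" "j \<in> {1, 2, 3}" for i j
    using assms(1) that by blast
  show ?thesis
    using *[of 1 2] *[of 1 3] *[of 2 1] *[of 2 3] *[of 3 1] *[of 3 2] assms(2,3)
    by (cases "P 1"; cases "P 2"; cases "P 3"; simp add: weight_eq of_bool_def split: if_splits)
qed

context extremal
begin

lemma fin: "S \<subseteq> {1..n} \<Longrightarrow> finite S"
  by (rule finite_subset) auto

lemma card_compl: "S \<subseteq> {1..n} \<Longrightarrow> card ({1..n} - S) = n - card S"
  by (simp add: card_Diff_subset fin)

lemma disjoint_set:
  assumes "S \<subseteq> {1..n}" "card S + k \<le> n"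
  obtains C where "C \<subseteq> {1..n}" "C \<inter> S = {}" "card C = k"
proof -
  have "k \<le> card ({1..n} - S)" using assms card_compl by simp
  then obtain C where "C \<subseteq> {1..n} - S" "card C = k" by (metis obtain_subset_with_card_n)
  then show thesis using that by blast
qed

text \<open>Zero rows of the incidence matrix at size \<open>m + 1\<close>. They will separate the
  first two extremal triples: either there are none or they form a star.\<close>

definition empty_sets :: "nat set set" where
  "empty_sets = {S. S \<subseteq> {1..n} \<and> card S = m + 1 \<and> none (\<lambda>i. S \<in> F i)}"

lemma not_both: "\<not> (full P \<and> none P)"
  by (auto simp: full_def none_def)

text \<open>Otherwise \<open>D - A\<close>, taken from the third family, completes a
  partition.\<close>

lemma cpf_full:
  assumes "full (\<lambda>i. D - A \<in> F i)" "A \<subseteq> D" "A \<in> F i" "D \<in> F j" "i \<noteq> j" "i \<in> {1, 2, 3}" "j \<in> {1, 2, 3}"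
  shows False
proof -
  have "transversal_free (\<lambda>i. A \<in> F i) (\<lambda>i. D - A \<in> F i) (\<lambda>i. D \<in> F i)"
    using assms(2) by (intro cross_transversal_free[OF cpf]) auto
  then show False using assms(1,3-) unfolding transversal_free_iff full_def by auto
qed

lemma half_split:
  assumes "D \<subseteq> {1..n}" "card D = 2 * m + 2" "B \<subseteq> D" "card B = m + 1"
  shows "full (\<lambda>i. B \<in> F i) \<and> full (\<lambda>i. D - B \<in> F i) \<and> none (\<lambda>i. D \<in> F i) \<or>
     w B = 2 \<and> (\<forall>i\<in>{1, 2, 3}. (D - B \<in> F i) = (B \<in> F i) \<and> (D \<in> F i) = (B \<in> F i)) \<or>
     full (\<lambda>i. B \<in> F i) \<and> none (\<lambda>i. D - B \<in> F i) \<and> full (\<lambda>i. D \<in> F i) \<or>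
     none (\<lambda>i. B \<in> F i) \<and> full (\<lambda>i. D - B \<in> F i) \<and> full (\<lambda>i. D \<in> F i)"
proof -
  have "card (D - B) = m + 1" using assms fin[of B] by (subst card_Diff_subset) auto
  moreover have "B \<union> (D - B) = D" using assms by auto
  moreover note middle_state[of B "D - B"]
  ultimately show ?thesis using assms by auto
qed

lemma pair_tight:
  assumes "a \<noteq> m" "A \<subseteq> {1..n}" "B \<subseteq> {1..n}" "card A = m" "card B = m + 1" "A \<inter> B = {}"
  shows "w A + w B + w (A \<union> B) = 6"
proof (rule triple_tight[OF cpf])
  have eq: "m + (m + 1) = 2 * m + 1" by simp
  show "f m + f (m + 1) + f (m + (m + 1)) = 6" unfolding eq using tight(3)[OF assms(1)] by simp
qed (use assms in auto)

text \<open>The source of the third extremal triple. By \<open>middle_state\<close> the two columns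
  of \<open>B0\<close> are passed on to every disjoint \<open>(m + 1)\<close>-set and to the union,
  and exchanges spread them over the whole level.\<close>

lemma two_thirds_case:
  assumes B0: "B0 \<subseteq> {1..n}" "card B0 = m + 1" "w B0 = 2"
  shows "a = m"
    and "\<And>S i. S \<subseteq> {1..n} \<Longrightarrow> card S = m + 1 \<or> card S = 2 * m + 2 \<Longrightarrow> i \<in> {1, 2, 3} \<Longrightarrow> S \<in> F i \<longleftrightarrow> B0 \<in> F i"
proof -
  let ?P = "\<lambda>S. \<forall>i\<in>{1, 2, 3}. S \<in> F i \<longleftrightarrow> B0 \<in> F i"
  have w2: "w S = 2" if "?P S" for S using that B0(3) by (simp add: weight_eq)
  have nfn: "\<not> full (\<lambda>i. S \<in> F i) \<and> \<not> none (\<lambda>i. S \<in> F i)" if "?P S" for S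
    using w2[OF that] by (simp add: full_iff none_iff)
  have pair: "?P S' \<and> ?P (S \<union> S')" if "S \<subseteq> {1..n}" "S' \<subseteq> {1..n}" "card S = m + 1" "card S' = m + 1" "S \<inter> S' = {}" "?P S" for S S'
    using middle_state[OF that(1-5)] nfn[OF that(6)] that(6) by auto
  have lev: "?P S" if "S \<subseteq> {1..n}" "card S = m + 1" for S
  proof (rule exchange_connected[where P = ?P, of "{1..n}" B0 S])
    fix T x y assume T: "T \<subseteq> {1..n}" "card T = card B0" "?P T" "x \<in> T" "y \<in> {1..n} - T"
    \<comment> \<open>A set \<open>C\<close> disjoint from \<open>insert y T\<close> is disjoint
      from \<open>T\<close> and from the exchanged set, so two transfers through \<open>C\<close>
      perform the exchange.\<close>
    have ins: "insert y T \<subseteq> {1..n}" "card (insert y T) = m + 2" using T B0 fin[of T] by auto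
    then obtain C where C: "C \<subseteq> {1..n}" "C \<inter> insert y T = {}" "card C = m + 1"
      using disjoint_set[of "insert y T" "m + 1"] n a_ge by auto
    have "?P C" using pair[of T C] T C B0 by auto
    moreover have "card (insert y (T - {x})) = m + 1" using ins(2) T fin[of T] B0
      by (simp add: card_Diff_singleton)
    ultimately show "?P (insert y (T - {x}))" using pair[of C "insert y (T - {x})"] T C by auto
  qed (use that B0 in auto)
  have lev2: "?P D" if "D \<subseteq> {1..n}" "card D = 2 * m + 2" for D
  proof -
    have "m + 1 \<le> card D" using that by simp
    then obtain B where B: "B \<subseteq> D" "card B = m + 1" by (metis obtain_subset_with_card_n)
    have "card (D - B) = m + 1" using B that fin[of B] by (subst card_Diff_subset) auto
    moreover have "B \<union> (D - B) = D" using B by auto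
    ultimately show ?thesis using pair[of B "D - B"] lev[of B] B that by auto
  qed
  \<comment> \<open>If \<open>a \<noteq> m\<close>, tightness puts some \<open>m\<close>-set
    \<open>A\<close> into a family \<open>F i\<close>. A \<open>(2 * m + 2)\<close>-set
    \<open>D\<close> above it lies in two families, one of them not \<open>F i\<close>, while
    \<open>D - A\<close> lies in a full layer.\<close>
  show "a = m"
  proof (rule ccontr)
    assume "a \<noteq> m"
    have "m \<le> card {1..n}" using n by simp
    then obtain A where A: "A \<subseteq> {1..n}" "card A = m" by (metis obtain_subset_with_card_n)
    obtain B where B: "B \<subseteq> {1..n}" "B \<inter> A = {}" "card B = m + 1"
      using disjoint_set[OF A(1), of "m + 1"] A n by auto
    have "w A + w B + w (A \<union> B) = 6" 
      using B(2) by (intro pair_tight \<open>a \<noteq> m\<close> A B(1,3)) auto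
    then have "1 \<le> w A" using w2[OF lev[OF B(1,3)]] weight_bounds(2)[of "\<lambda>i. A \<union> B \<in> F i"] by linarith
    then obtain i where i: "i \<in> {1, 2, 3}" "A \<in> F i" by (auto simp: weight_eq of_bool_def split: if_splits)
    have "\<exists>D. A \<subseteq> D \<and> D \<subseteq> {1..n} \<and> card D = 2 * m + 2"
      using A n by (intro exists_subset_between) auto
    then obtain D where D: "A \<subseteq> D" "D \<subseteq> {1..n}" "card D = 2 * m + 2" by blast
    have "w D = 2" using w2 lev2 D by blast
    have "\<exists>j\<in>{1, 2, 3}. D \<in> F j \<and> j \<noteq> i"
    proof (rule ccontr)
      assume "\<not> ?thesis"
      then have "w D \<le> (\<Sum>j\<in>{1, 2, 3}. if j = i then 1 else 0)"
        unfolding weight_def by (intro sum_mono) auto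
      also have "\<dots> \<le> 1" by simp
      finally show False using \<open>w D = 2\<close> by simp
    qed
    then obtain j where j: "j \<in> {1, 2, 3}" "D \<in> F j" "j \<noteq> i" by blast
    have "card (D - A) = m + 2" using D A fin[of A] by (subst card_Diff_subset) auto
    then have "full (\<lambda>i. D - A \<in> F i)" using D a_ge by (intro full_middle) auto
    then show False using cpf_full[of D A i j] D i j by auto
  qed
  show "S \<in> F i \<longleftrightarrow> B0 \<in> F i" if "S \<subseteq> {1..n}" "card S = m + 1 \<or> card S = 2 * m + 2" "i \<in> {1, 2, 3}" for S i
    using that lev lev2 by blast
qed

section \<open>Extremal families whose \<open>(m + 1)\<close>-sets lie in all three or in
  none\<close>

context
  assumes no_two: "\<And>S. S \<subseteq> {1..n} \<Longrightarrow> card S = m + 1 \<Longrightarrow> w S \<noteq> 2"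
begin

lemma full_or_none:
  assumes "B \<subseteq> {1..n}" "card B = m + 1"
  shows "full (\<lambda>i. B \<in> F i) \<longleftrightarrow> B \<notin> empty_sets"
proof -
  obtain C where "C \<subseteq> {1..n}" "C \<inter> B = {}" "card C = m + 1"
    using disjoint_set[OF assms(1), of "m + 1"] assms n by auto
  then show ?thesis
    using middle_state[of B C] no_two[OF assms] assms not_both[of "\<lambda>i. B \<in> F i"]
    unfolding empty_sets_def by auto
qed

lemma half_cases:
  assumes "D \<subseteq> {1..n}" "card D = 2 * m + 2" "B \<subseteq> D" "card B = m + 1"
  shows "B \<notin> empty_sets \<and> D - B \<notin> empty_sets \<and> none (\<lambda>i. D \<in> F i) \<or>
     (B \<in> empty_sets \<longleftrightarrow> D - B \<notin> empty_sets) \<and> full (\<lambda>i. D \<in> F i)"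
proof -
  have c: "card (D - B) = m + 1" using assms fin[of B] by (subst card_Diff_subset) auto
  have s: "B \<subseteq> {1..n}" "D - B \<subseteq> {1..n}" using assms by auto
  show ?thesis
    using half_split[OF assms] no_two[OF s(1) assms(4)] full_or_none[OF s(1) assms(4)]
      full_or_none[OF s(2) c] not_both[of "\<lambda>i. B \<in> F i"] not_both[of "\<lambda>i. D - B \<in> F i"]
      s c assms unfolding empty_sets_def by auto
qed

lemma above_empty:
  assumes "X \<in> empty_sets" "X \<subseteq> D" "D \<subseteq> {1..n}" "card D = 2 * m + 2"
  shows "full (\<lambda>i. D \<in> F i)"
  using half_cases[of D X] assms unfolding empty_sets_def by auto

lemma half_above_empty:
  assumes "X \<in> empty_sets" "X \<subseteq> D" "D \<subseteq> {1..n}" "card D = 2 * m + 2" "S \<subseteq> D" "card S = m + 1"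
  shows "D - S \<in> empty_sets \<longleftrightarrow> S \<notin> empty_sets"
  using half_cases[OF assms(3-6)] above_empty[OF assms(1-4)] not_both[of "\<lambda>i. D \<in> F i"] by auto

lemma empty_intersecting:
  assumes "X \<in> empty_sets" "Y \<in> empty_sets"
  shows "X \<inter> Y \<noteq> {}"
proof
  assume "X \<inter> Y = {}"
  then have "full (\<lambda>i. Y \<in> F i)"
    using middle_state[of X Y] assms no_two not_both[of "\<lambda>i. X \<in> F i"] unfolding empty_sets_def by auto
  then show False using assms full_or_none[of Y] unfolding empty_sets_def by auto
qed

text \<open>An empty \<open>B\<close> forces a disjoint \<open>m\<close>-set \<open>A\<close> to be
  full by tightness. A \<open>(2 * m + 2)\<close>-set \<open>D\<close> above both is full as well,
  and so is \<open>D - A\<close>, of size \<open>m + 2\<close>: a forbidden triple.\<close>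

lemma small_case_no_empty:
  assumes "a \<noteq> m"
  shows "empty_sets = {}"
proof (rule ccontr)
  assume "empty_sets \<noteq> {}"
  then obtain B where B: "B \<in> empty_sets" "B \<subseteq> {1..n}" "card B = m + 1" "w B = 0"
    unfolding empty_sets_def none_iff by auto
  obtain A where A: "A \<subseteq> {1..n}" "A \<inter> B = {}" "card A = m"
    using disjoint_set[OF B(2), of m] B n by auto
  have "w A + w B + w (A \<union> B) = 6" by (rule pair_tight[OF assms A(1) B(2) A(3) B(3) A(2)])
  then have "w A = 3" using B(4) weight_bounds(2)[of "\<lambda>i. A \<union> B \<in> F i"] weight_bounds(2)[of "\<lambda>i. A \<in> F i"] by linarith
  then have "A \<in> F 1" using full_iff[of "\<lambda>i. A \<in> F i"] by (simp add: full_def)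
  have "card (A \<union> B) = 2 * m + 1" using A B fin by (subst card_Un_disjoint) auto
  then have "\<exists>D. A \<union> B \<subseteq> D \<and> D \<subseteq> {1..n} \<and> card D = 2 * m + 2"
    using A B n by (intro exists_subset_between) auto
  then obtain D where D: "A \<union> B \<subseteq> D" "D \<subseteq> {1..n}" "card D = 2 * m + 2" by blast
  have "D \<in> F 2" using above_empty[OF B(1), of D] D by (auto simp: full_def)
  have "card (D - A) = m + 2" using D A fin[of A] by (subst card_Diff_subset) auto
  then have "full (\<lambda>i. D - A \<in> F i)" using D a_ge by (intro full_middle) auto
  then show False using cpf_full[of D A 1 2] D \<open>A \<in> F 1\<close> \<open>D \<in> F 2\<close> by auto
qed

lemma small_case:
  assumes "a \<noteq> m" "S \<subseteq> {1..n}"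
  shows "card S = m \<Longrightarrow> none (\<lambda>i. S \<in> F i)" "card S = 2 * m + 1 \<Longrightarrow> full (\<lambda>i. S \<in> F i)"
proof -
  \<comment> \<open>Inside \<open>C\<close> every \<open>m\<close>-set has weight
    \<open>3 - w C\<close>, because its complement in \<open>C\<close> is full.\<close>
  have zero: "w A = 0" if A: "A \<subseteq> C" "card A = m" and C: "C \<subseteq> {1..n}" "card C = 2 * m + 1" for A C
  proof (rule ccontr)
    assume "w A \<noteq> 0"
    have sum3: "w A' + w C = 3 \<and> full (\<lambda>i. C - A' \<in> F i)" if "A' \<subseteq> C" "card A' = m" for A'
    proof -
      have c: "card (C - A') = m + 1" using that C fin[of A'] by (subst card_Diff_subset) auto
      have "A' \<union> (C - A') = C" using that by auto
      then have "w A' + w (C - A') + w C = 6" using pair_tight[OF assms(1), of A' "C - A'"] c that C by auto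
      moreover have "full (\<lambda>i. C - A' \<in> F i)"
        using full_or_none[of "C - A'"] small_case_no_empty[OF assms(1)] c C by auto
      ultimately show ?thesis by (simp add: full_iff)
    qed
    have "w C = 0"
    proof (rule ccontr)
      assume "w C \<noteq> 0"
      have "\<forall>i\<in>{1, 2, 3}. \<forall>j\<in>{1, 2, 3}. i \<noteq> j \<longrightarrow> \<not> (A \<in> F i \<and> C \<in> F j)"
        using cpf_full[of C A] sum3[OF A] A by blast
      then have "w A + w C \<le> 2" using \<open>w A \<noteq> 0\<close> \<open>w C \<noteq> 0\<close> by (rule weight_exclusive)
      then show False using sum3[OF A] by simp
    qed
    \<comment> \<open>So all \<open>m\<close>-subsets of \<open>C\<close> are full. Two disjoint
      ones have a union of size \<open>2 * m = a + m + 1\<close>, again full, which is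
      impossible.\<close>
    have "m \<le> card (C - A)" using A C fin[of A] by (subst card_Diff_subset) auto
    then obtain A' where A': "A' \<subseteq> C - A" "card A' = m" by (metis obtain_subset_with_card_n)
    have "full (\<lambda>i. A \<in> F i)" "full (\<lambda>i. A' \<in> F i)"
      using sum3[OF A] sum3[of A'] A' \<open>w C = 0\<close> by (auto simp: full_iff)
    then have "A \<in> F 1" "A' \<in> F 2" by (auto simp: full_def)
    have s: "A \<subseteq> {1..n}" "A' \<subseteq> {1..n}" "A \<union> A' \<subseteq> {1..n}" using A A' C by auto
    have "finite A" "finite A'" using s fin by blast+
    then have c: "card (A \<union> A') = 2 * m" using A A' by (subst card_Un_disjoint) auto
    have "full (\<lambda>i. A \<union> A' \<in> F i)" using c s(3) a_ge by (intro full_middle) auto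
    then have "A \<union> A' \<in> F 3" by (simp add: full_def)
    moreover have "transversal_free (\<lambda>i. A \<in> F i) (\<lambda>i. A' \<in> F i) (\<lambda>i. A \<union> A' \<in> F i)"
      using A' by (intro cross_transversal_free[OF cpf]) auto
    ultimately show False using \<open>A \<in> F 1\<close> \<open>A' \<in> F 2\<close> unfolding transversal_free_iff by auto
  qed
  show "none (\<lambda>i. S \<in> F i)" if "card S = m"
  proof -
    have "\<exists>C. S \<subseteq> C \<and> C \<subseteq> {1..n} \<and> card C = 2 * m + 1"
      using assms that n by (intro exists_subset_between) auto
    then obtain C where C: "S \<subseteq> C" "C \<subseteq> {1..n}" "card C = 2 * m + 1" by blast
    then show ?thesis using zero[of S C] that by (simp add: none_iff)
  qed
  show "full (\<lambda>i. S \<in> F i)" if c: "card S = 2 * m + 1"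
  proof -
    have "m \<le> card S" using c by simp
    then obtain A where A: "A \<subseteq> S" "card A = m" by (metis obtain_subset_with_card_n)
    have "card (S - A) = m + 1" using A c assms fin[of A] by (subst card_Diff_subset) auto
    moreover have "A \<union> (S - A) = S" using A by auto
    ultimately have "w A + w (S - A) + w S = 6" using pair_tight[OF assms(1), of A "S - A"] A assms(2) by auto
    then show ?thesis using zero[OF A assms(2) c] weight_bounds(2)[of "\<lambda>i. S - A \<in> F i"]
      weight_bounds(2)[of "\<lambda>i. S \<in> F i"] unfolding full_iff by linarith
  qed
qed

lemma none_2m2:
  assumes "D \<subseteq> {1..n}" "card D = 2 * m + 2" "\<And>B. B \<subseteq> D \<Longrightarrow> B \<notin> empty_sets"
  shows "none (\<lambda>i. D \<in> F i)"
proof -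
  have "m + 1 \<le> card D" using assms by simp
  then obtain B where "B \<subseteq> D" "card B = m + 1" by (metis obtain_subset_with_card_n)
  then show ?thesis using half_cases[of D B] assms by auto
qed

text \<open>The centre is the element whose removal by a single exchange leaves
  \<open>empty_sets\<close>. Splitting suitable \<open>(2 * m + 2)\<close>-sets into halves, exactly
  one of which is empty, yields both inclusions.\<close>

lemma empty_star:
  assumes "a = m" "empty_sets \<noteq> {}"
  obtains x where "x \<in> {1..n}" "empty_sets = {S. S \<subseteq> {1..n} \<and> card S = m + 1 \<and> x \<in> S}"
proof -
  have n': "n = 3 * m + 2" using n assms by simp
  obtain X0 where X0: "X0 \<in> empty_sets" "X0 \<subseteq> {1..n}" "card X0 = m + 1"
    using assms unfolding empty_sets_def by auto
  obtain Z where Z: "Z \<subseteq> {1..n}" "Z \<inter> X0 = {}" "card Z = m + 1"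
    using disjoint_set[OF X0(2), of "m + 1"] X0 n by auto
  have "Z \<notin> empty_sets" using empty_intersecting[OF _ X0(1), of Z] Z by auto
  \<comment> \<open>Not every \<open>(m + 1)\<close>-set is empty, as \<open>Z\<close> shows, so by
    connectedness some exchange leads out of \<open>empty_sets\<close>.\<close>
  have "\<exists>X x y. X \<in> empty_sets \<and> x \<in> X \<and> y \<in> {1..n} - X \<and> insert y (X - {x}) \<notin> empty_sets"
  proof (rule ccontr)
    assume "\<not> ?thesis"
    then have "Z \<in> empty_sets"
      using exchange_connected[of "{1..n}" X0 "\<lambda>S. S \<in> empty_sets" Z] X0 Z by auto
    then show False using \<open>Z \<notin> empty_sets\<close> by simp
  qed
  then obtain X x y where X: "X \<in> empty_sets" "x \<in> X" "y \<in> {1..n}" "y \<notin> X" "insert y (X - {x}) \<notin> empty_sets"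
    by auto
  have X': "X \<subseteq> {1..n}" "card X = m + 1" "finite X" using X(1) fin unfolding empty_sets_def by auto
  have star: "x \<in> Y" if Y: "Y \<in> empty_sets" for Y
  proof (rule ccontr)
    assume "x \<notin> Y"
    have Y': "Y \<subseteq> {1..n}" "card Y = m + 1" "finite Y" using Y fin unfolding empty_sets_def by auto
    \<comment> \<open>Room for \<open>m\<close> points off both \<open>insert y X\<close> and
      \<open>Y\<close>: there are \<open>2 * m\<close> points outside \<open>insert y X\<close>, and
      at most \<open>m\<close> of them are in \<open>Y\<close>, since \<open>Y\<close> meets
      \<open>X\<close>.\<close>
    let ?R = "{1..n} - insert y X"
    have "card (Y \<inter> X) > 0" using empty_intersecting[OF Y X(1)] Y' by (simp add: card_gt_0_iff)
    then have "card (Y - X) \<le> m" using Y' card_Diff_subset_Int[of Y X] by simp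
    have "card (insert y X) = m + 2" using X X' by simp
    then have R: "card ?R = 2 * m" using X X' n' by (subst card_compl) auto
    have "card (?R \<inter> Y) \<le> card (Y - X)" using Y' by (intro card_mono) auto
    then have "m \<le> card (?R - Y)" using R \<open>card (Y - X) \<le> m\<close> by (subst card_Diff_subset_Int) auto
    then obtain W where W: "W \<subseteq> ?R - Y" "card W = m" by (metis obtain_subset_with_card_n)
    have finW: "finite W" using W fin by (meson Diff_subset subset_trans)
    let ?D = "insert y X \<union> W"
    have D: "?D \<subseteq> {1..n}" "card ?D = 2 * m + 2"
    proof -
      show "?D \<subseteq> {1..n}" using W X X' by auto
      have "insert y X \<inter> W = {}" "finite (insert y X)" using W X' by auto
      then show "card ?D = 2 * m + 2"
        using W(2) finW \<open>card (insert y X) = m + 2\<close> by (subst card_Un_disjoint) auto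
    qed
    have "card (insert y (X - {x})) = m + 1" using X X' by simp
    \<comment> \<open>The exchanged set is a nonempty half of \<open>?D\<close>, so the other half,
      contained in \<open>insert x W\<close>, is empty; but it misses \<open>Y\<close>.\<close>
    then have "?D - insert y (X - {x}) \<in> empty_sets"
      using half_above_empty[OF X(1) _ D, of "insert y (X - {x})"] X by auto
    then have "(?D - insert y (X - {x})) \<inter> Y \<noteq> {}" using Y by (rule empty_intersecting)
    moreover have "?D - insert y (X - {x}) \<subseteq> insert x W" by auto
    ultimately show False using W \<open>x \<notin> Y\<close> by auto
  qed
  \<comment> \<open>If \<open>S\<close> were not empty, its complement in a set \<open>D\<close>
    above \<open>X\<close> and \<open>S\<close> would be, although it misses
    \<open>x\<close>.\<close>
  have "S \<in> empty_sets" if S: "S \<subseteq> {1..n}" "card S = m + 1" "x \<in> S" for S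
  proof (rule ccontr)
    assume "S \<notin> empty_sets"
    have "card (X \<union> S) \<le> 2 * m + 2" using card_Un_le[of X S] X' S by simp
    then have "\<exists>D. X \<union> S \<subseteq> D \<and> D \<subseteq> {1..n} \<and> card D = 2 * m + 2"
      using X' S n by (intro exists_subset_between) auto
    then obtain D where D: "X \<union> S \<subseteq> D" "D \<subseteq> {1..n}" "card D = 2 * m + 2" by blast
    have "D - S \<in> empty_sets"
      using half_above_empty[OF X(1) _ D(2,3), of S] D S \<open>S \<notin> empty_sets\<close> by auto
    then show False using star S by auto
  qed
  then have "empty_sets = {S. S \<subseteq> {1..n} \<and> card S = m + 1 \<and> x \<in> S}"
    using star unfolding empty_sets_def by auto
  moreover have "x \<in> {1..n}" using X X' by auto
  ultimately show thesis using that by blast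
qed

end

end

section \<open>Identification with the listed triples\<close>

lemma same_up_to_perm_refl:
  assumes "\<forall>i\<in>{1, 2, 3}. F i = G i"
  shows "same_up_to_perm n F G"
  unfolding same_up_to_perm_def
  by (rule exI[of _ id], rule exI[of _ id]) (use assms in \<open>simp add: permutes_id\<close>)

lemma mem_image_transpose_iff:
  "S \<in> (`) (transpose x y) ` G \<longleftrightarrow> transpose x y ` S \<in> G"
proof
  assume "transpose x y ` S \<in> G"
  then have "transpose x y ` transpose x y ` S \<in> (`) (transpose x y) ` G" by blast
  then show "S \<in> (`) (transpose x y) ` G" by (simp add: image_image)
qed (auto simp: image_image)

text \<open>The transposition moves \<open>x\<close> to the last point, which
  \<open>doubling\<close> ignores.\<close>

lemma card_Int_transpose:
  fixes x n :: nat
  assumes "x \<in> {1..n + 1}" "S \<subseteq> {1..n + 1}"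
  shows "card (transpose x (n + 1) ` S \<inter> {1..n}) = card (S - {x})"
proof -
  let ?t = "transpose x (n + 1)"
  have t: "?t permutes {1..n + 1}" using assms(1) by (intro permutes_swap_id) auto
  have "{1..n} = {1..n + 1} - {n + 1}" by auto
  moreover have "?t ` S \<subseteq> {1..n + 1}" using image_mono[OF assms(2), of ?t] permutes_image[OF t] by simp
  ultimately have "?t ` S \<inter> {1..n} = ?t ` S - ?t ` {x}" by auto
  also have "\<dots> = ?t ` (S - {x})" using permutes_inj[OF t] by (simp add: image_set_diff)
  finally show ?thesis using permutes_inj[OF t] by (simp add: card_image inj_on_subset)
qed

context extremal
begin

lemma card_range:
  assumes "S \<in> F i" "i \<in> {1, 2, 3}"
  shows "S \<subseteq> {1..n}" "a < card S" "card S \<le> 2 * m + 2"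
proof -
  show S: "S \<subseteq> {1..n}" using assms sub by auto
  have no: "\<not> none (\<lambda>i. S \<in> F i)" using assms by (auto simp: none_def)
  show "a < card S" using none_low[OF S] none_a[OF S] no by (meson linorder_neqE_nat)
  show "card S \<le> 2 * m + 2"
  proof (rule ccontr)
    assume "\<not> ?thesis"
    then have "card S = 2 * m + 3 \<or> 2 * m + 4 \<le> card S" by linarith
    then show False using none_high[OF S] none_2m3[OF S] no by blast
  qed
qed

lemma mem_middle:
  "S \<subseteq> {1..n} \<Longrightarrow> m + 2 \<le> card S \<Longrightarrow> card S \<le> a + m + 1 \<Longrightarrow> i \<in> {1, 2, 3} \<Longrightarrow> S \<in> F i"
  using full_middle[of S] by (auto simp: full_def)

lemma mem_empty_sets: "S \<in> empty_sets \<Longrightarrow> i \<in> {1, 2, 3} \<Longrightarrow> S \<notin> F i"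
  by (auto simp: empty_sets_def none_def)

lemma classification_small:
  assumes "a \<noteq> m" "i \<in> {1, 2, 3}"
  shows "F i = KK (3 * m + 1)"
proof -
  have n': "n = 3 * m + 1" "a + m + 1 = 2 * m" using n a_ge(4) assms by auto
  have no_two: "w S \<noteq> 2" if "S \<subseteq> {1..n}" "card S = m + 1" for S
    using two_thirds_case(1)[OF that] assms by auto
  have "S \<in> F i \<longleftrightarrow> m + 1 \<le> card S \<and> card S \<le> 2 * m + 1" if S: "S \<subseteq> {1..n}" for S
  proof
    assume SF: "S \<in> F i"
    have no: "\<not> none (\<lambda>i. S \<in> F i)" using SF assms by (auto simp: none_def)
    have "card S \<noteq> m" using small_case(1)[OF no_two assms(1) S] no by blast
    moreover have "card S \<noteq> 2 * m + 2"
      using none_2m2[OF no_two S] small_case_no_empty[OF no_two assms(1)] no by blast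
    ultimately show "m + 1 \<le> card S \<and> card S \<le> 2 * m + 1"
      using card_range[OF SF assms(2)] a_ge(4)[OF assms(1)] by linarith
  next
    assume c: "m + 1 \<le> card S \<and> card S \<le> 2 * m + 1"
    consider "card S = m + 1" | "card S = 2 * m + 1" | "m + 2 \<le> card S" "card S \<le> a + m + 1"
      using c n' by linarith
    then show "S \<in> F i"
    proof cases
      case 1
      then have "full (\<lambda>i. S \<in> F i)"
        using full_or_none[OF no_two S] small_case_no_empty[OF no_two assms(1)] by blast
      then show ?thesis using assms(2) by (auto simp: full_def)
    next
      case 2
      then have "full (\<lambda>i. S \<in> F i)" using small_case(2)[OF no_two assms(1) S] by blast
      then show ?thesis using assms(2) by (auto simp: full_def)
    next
      case 3
      then show ?thesis using mem_middle S assms(2) by blast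
    qed
  qed
  moreover have "(3 * m + 1) div 3 = m" by simp
  ultimately show ?thesis
    using sub assms(2) unfolding KK_def layers_def n'(1) by auto
qed

text \<open>An \<open>(m + 1)\<close>-set of weight 2 gives the third triple; otherwise no empty set
  gives the first one and a star of empty sets the second one.\<close>

lemma classification_large:
  assumes "a = m"
  shows "same_up_to_perm n F (\<lambda>i. KK (3 * m + 2))
    \<or> same_up_to_perm n F (\<lambda>i. doubling (3 * m + 1) (KK (3 * m + 1)))
    \<or> same_up_to_perm n F
        (\<lambda>i. if i = 1 then layers n (m + 2) (2 * m + 1) else layers n (m + 1) (2 * m + 2))"
proof -
  have n': "n = 3 * m + 2" using n assms by simp
  have div: "(3 * m + 2) div 3 = m" "(3 * m + 1) div 3 = m" by simp_all
  have mem: "S \<in> F i \<longleftrightarrow> S \<subseteq> {1..n} \<and> (m + 2 \<le> card S \<and> card S \<le> 2 * m + 1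
      \<or> (card S = m + 1 \<or> card S = 2 * m + 2) \<and> S \<in> F i)" if "i \<in> {1, 2, 3}" for S i
    using card_range[OF _ that, of S] mem_middle[of S i] that assms by auto
  show ?thesis
  proof (cases "\<exists>B0\<subseteq>{1..n}. card B0 = m + 1 \<and> w B0 = 2")
    case True
    then obtain B0 where B0: "B0 \<subseteq> {1..n}" "card B0 = m + 1" "w B0 = 2" by blast
    have "\<exists>k\<in>{1, 2, 3}. \<forall>i\<in>{1, 2, 3}. B0 \<in> F i \<longleftrightarrow> i \<noteq> k"
      using B0(3) by (cases "B0 \<in> F 1"; cases "B0 \<in> F 2"; cases "B0 \<in> F 3") (auto simp: weight_eq)
    then obtain k where k: "k \<in> {1, 2, 3}" "\<And>i. i \<in> {1, 2, 3} \<Longrightarrow> B0 \<in> F i \<longleftrightarrow> i \<noteq> k" by blast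
    have mem2: "S \<in> F i \<longleftrightarrow> S \<subseteq> {1..n} \<and> (m + 2 \<le> card S \<and> card S \<le> 2 * m + 1
      \<or> (card S = m + 1 \<or> card S = 2 * m + 2) \<and> i \<noteq> k)" if "i \<in> {1, 2, 3}" for S i
      using mem[OF that, of S] two_thirds_case(2)[OF B0 _ _ that, of S] k(2)[OF that] by blast
    \<comment> \<open>\<open>k\<close> is the family that omits the layers \<open>m + 1\<close> and
      \<open>2 * m + 2\<close>; it has to become the first.\<close>
    let ?s = "transpose 1 k"
    have s: "?s permutes {1, 2, 3}" using k(1) by (intro permutes_swap_id) auto
    have "F (?s i) = (if i = 1 then layers n (m + 2) (2 * m + 1) else layers n (m + 1) (2 * m + 2))"
      if i: "i \<in> {1, 2, 3}" for i
    proof -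
      have si: "?s i \<in> {1, 2, 3}" using s i by (simp only: permutes_in_image)
      have "?s i = k \<longleftrightarrow> i = 1" by (auto simp: transpose_def)
      moreover have "F (?s i) = {S. S \<subseteq> {1..n} \<and> (m + 2 \<le> card S \<and> card S \<le> 2 * m + 1
          \<or> (card S = m + 1 \<or> card S = 2 * m + 2) \<and> ?s i \<noteq> k)}"
        by (rule set_eqI) (simp only: mem2[OF si] mem_Collect_eq)
      ultimately show ?thesis unfolding layers_def by (cases "i = 1") (simp_all, rule Collect_cong, linarith)
    qed
    then have "same_up_to_perm n F
        (\<lambda>i. if i = 1 then layers n (m + 2) (2 * m + 1) else layers n (m + 1) (2 * m + 2))"
      unfolding same_up_to_perm_def using s
      by (intro exI[of _ ?s] exI[of _ id]) (simp add: permutes_id del: One_nat_def)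
    then show ?thesis by blast
  next
    case False
    then have no_two: "w S \<noteq> 2" if "S \<subseteq> {1..n}" "card S = m + 1" for S using that by blast
    have low: "S \<in> F i \<longleftrightarrow> S \<notin> empty_sets" if "i \<in> {1, 2, 3}" "S \<subseteq> {1..n}" "card S = m + 1" for S i
      using full_or_none[OF no_two that(2,3)] mem_empty_sets[of S i] that(1) by (auto simp: full_def)
    show ?thesis
    proof (cases "empty_sets = {}")
      case True
      have "F i = KK (3 * m + 2)" if i: "i \<in> {1, 2, 3}" for i
      proof -
        have "S \<notin> F i" if "S \<subseteq> {1..n}" "card S = 2 * m + 2" for S
          using none_2m2[OF no_two that] True i by (auto simp: none_def)
        then have "S \<in> F i \<longleftrightarrow> S \<subseteq> {1..n} \<and> m + 1 \<le> card S \<and> card S \<le> 2 * m + 1" for S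
          using mem[OF i, of S] low[OF i, of S] True by auto
        then show ?thesis by (simp only: set_eq_iff mem_Collect_eq KK_def layers_def div n' simp_thms)
      qed
      then have "same_up_to_perm n F (\<lambda>i. KK (3 * m + 2))" by (intro same_up_to_perm_refl ballI)
      then show ?thesis ..
    next
      case False
      obtain x where x: "x \<in> {1..n}" "empty_sets = {S. S \<subseteq> {1..n} \<and> card S = m + 1 \<and> x \<in> S}"
        using empty_star[OF no_two assms False] by blast
      have high: "S \<in> F i \<longleftrightarrow> x \<in> S" if i: "i \<in> {1, 2, 3}" and S: "S \<subseteq> {1..n}" "card S = 2 * m + 2" for S i
      proof
        assume "x \<in> S"
        then have "\<exists>B. {x} \<subseteq> B \<and> B \<subseteq> S \<and> card B = m + 1"
          using S fin[OF S(1)] by (intro exists_subset_between) auto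
        then obtain B where "x \<in> B" "B \<subseteq> S" "card B = m + 1" by blast
        then show "S \<in> F i" using above_empty[OF no_two, of B S] S x i by (auto simp: full_def)
      next
        assume "S \<in> F i"
        then show "x \<in> S" using none_2m2[OF no_two S] x(2) i by (auto simp: none_def)
      qed
      \<comment> \<open>The centre \<open>x\<close> is moved to \<open>n\<close>. Membership then
        depends on \<open>card (S - {x})\<close> alone: \<open>(m + 1)\<close>-sets must avoid
        \<open>x\<close>, and \<open>(2 * m + 2)\<close>-sets must contain it.\<close>
      let ?p = "transpose x n"
      have p: "?p permutes {1..n}" using x(1) n by (intro permutes_swap_id) auto
      have F: "F i = (\<lambda>A. ?p ` A) ` doubling (3 * m + 1) (KK (3 * m + 1))" if i: "i \<in> {1, 2, 3}" for i
      proof (rule set_eqI)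
        fix S
        show "S \<in> F i \<longleftrightarrow> S \<in> (\<lambda>A. ?p ` A) ` doubling (3 * m + 1) (KK (3 * m + 1))"
        proof (cases "S \<subseteq> {1..n}")
          case False
          moreover have "\<not> ?p ` S \<subseteq> {1..n}"
            using False image_mono[of "?p ` S" "{1..n}" ?p] permutes_image[OF p] by (auto simp: image_image)
          ultimately show ?thesis
            using mem[OF i, of S] n' unfolding mem_image_transpose_iff doubling_def by auto
        next
          case True
          have n1: "n = 3 * m + 1 + 1" using n' by simp
          have "?p ` S \<subseteq> {1..n}" using image_mono[OF True, of ?p] permutes_image[OF p] by simp
          then have "S \<in> (\<lambda>A. ?p ` A) ` doubling (3 * m + 1) (KK (3 * m + 1)) \<longleftrightarrow>
             m + 1 \<le> card (?p ` S \<inter> {1..3 * m + 1}) \<and> card (?p ` S \<inter> {1..3 * m + 1}) \<le> 2 * m + 1"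
            unfolding mem_image_transpose_iff doubling_def KK_def layers_def div n1 by auto
          also have "card (?p ` S \<inter> {1..3 * m + 1}) = card (S - {x})"
            using card_Int_transpose[of x "3 * m + 1" S] x(1) True unfolding n1 by simp
          also have "m + 1 \<le> card (S - {x}) \<and> card (S - {x}) \<le> 2 * m + 1 \<longleftrightarrow> S \<in> F i"
          proof -
            have c: "card (S - {x}) + (if x \<in> S then 1 else 0) = card S"
              using fin[OF \<open>S \<subseteq> {1..n}\<close>] card_Suc_Diff1[of S x] by auto
            consider "card S = m + 1" | "card S = 2 * m + 2" | "card S \<noteq> m + 1" "card S \<noteq> 2 * m + 2"
              by blast
            then show ?thesis
            proof cases
              case 1
              then have "S \<in> F i \<longleftrightarrow> x \<notin> S" using low[OF i True] x(2) True by blast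
              then show ?thesis using c 1 by (simp split: if_splits)
            next
              case 2
              then show ?thesis using c high[OF i True] by (simp split: if_splits)
            next
              case 3
              then have "S \<in> F i \<longleftrightarrow> m + 2 \<le> card S \<and> card S \<le> 2 * m + 1" using mem[OF i, of S] True by blast
              then show ?thesis using c 3 by (simp split: if_splits) linarith+
            qed
          qed
          finally show ?thesis by simp
        qed
      qed
      have "same_up_to_perm n F (\<lambda>i. doubling (3 * m + 1) (KK (3 * m + 1)))"
        unfolding same_up_to_perm_def
      proof (intro exI conjI ballI)
        show "F (id i) = (\<lambda>A. ?p ` A) ` doubling (3 * m + 1) (KK (3 * m + 1))"
          if "i \<in> {1, 2, 3}" for i
          unfolding id_apply using that by (rule F)
      qed (rule permutes_id p)+
      then show ?thesis by blast
    qed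
  qed
qed

end

theorem theorem3:
  fixes m n :: nat and F :: "nat \<Rightarrow> nat set set"
  assumes "m \<ge> 6"
    and "n = 3 * m + 1 \<or> n = 3 * m + 2"
    and "\<forall>i\<in>{1, 2, 3}. F i \<subseteq> Pow {1..n}"
    and "cross_partition_free F"
  shows "card (F 1) + card (F 2) + card (F 3) \<le> 3 * (\<Sum>t = m + 1..2 * m + 1. n choose t)
    \<and> (n = 3 * m + 1
         \<and> card (F 1) + card (F 2) + card (F 3) = 3 * (\<Sum>t = m + 1..2 * m + 1. n choose t)
         \<longrightarrow> F 1 = KK (3 * m + 1) \<and> F 2 = KK (3 * m + 1) \<and> F 3 = KK (3 * m + 1))
    \<and> (n = 3 * m + 2
         \<and> card (F 1) + card (F 2) + card (F 3) = 3 * (\<Sum>t = m + 1..2 * m + 1. n choose t)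
         \<longrightarrow> same_up_to_perm n F (\<lambda>i. KK (3 * m + 2))
           \<or> same_up_to_perm n F (\<lambda>i. doubling (3 * m + 1) (KK (3 * m + 1)))
           \<or> same_up_to_perm n F
               (\<lambda>i. if i = 1 then layers n (m + 2) (2 * m + 1) else layers n (m + 1) (2 * m + 2)))"
proof -
  \<comment> \<open>This turns \<open>n = 3 * m + 2\<close> into \<open>a = m\<close> and
    \<open>n = 3 * m + 1\<close> into \<open>Suc a = m\<close>.\<close>
  define a where "a = n - 2 * m - 2"
  have cases: "a \<noteq> m \<longleftrightarrow> n = 3 * m + 1" "a = m \<longleftrightarrow> n = 3 * m + 2"
    using assms(1,2) unfolding a_def by auto
  interpret families n m a F
    by unfold_locales (use assms in \<open>auto simp: a_def\<close>)
  have ext: "extremal n m a F"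
    if "card (F 1) + card (F 2) + card (F 3) = 3 * (\<Sum>t = m + 1..2 * m + 1. n choose t)"
    using that by unfold_locales
  show ?thesis
    using card_bound extremal.classification_small[OF ext] extremal.classification_large[OF ext] cases by blast
qed

end
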